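(* Suppose $1\le p\le2$ and $r>0$ (with $r\ge1/4$ if $p=1$). Let $T:\ell_2(\mathcal{I})\to\ell_2(\mathcal{K})$ be a bounded linear operator with $\|T\|<1$ ($\mathcal{I},\mathcal{K}$ countable index sets), let $g\in\ell_2(\mathcal{K})$, and let $$\mathcal{J}^p_r(u)=\|Tu-g\|^2_{\ell_2(\mathcal{K})}+\sum_{i\in\mathcal{I}}\min\{|u_i|^p,r^p\}.$$ Starting from any $u^0\in\ell_2(\mathcal{I})$ satisfying $\mathcal{J}^p_r(u^0)<\infty$, the sequence $u^{n+1}=\mathbb{H}(u^n)$, defined by $[\mathbb{H}(u)]_i=H_{(p,r)}([u-T^*Tu+T^*g]_i)$ for $i\in\mathcal I$, converges weakly to a vector $\bar u\in\ell_2(\mathcal{I})$ that satisfies the fixed point condition: 1. $|\bar u_i|\ge\lambda'(r,p)$ if $i\in\mathcal{I}_1=\{j\in\mathcal{I}:|\bar u_j|>r\}$; 2. for $p>1$, $|\bar u_i|\le F_p^{-1}(\lambda'(r,p))$ if $i\in\mathcal{I}_0=\{j\in\mathcal{I}:|\bar u_j|\le r\}$; 3. (a) if $p>1$: $$[T^*(g-T\bar u)]_i=\begin{cases} 0, & \text{if }|\bar u_i|\ge\lambda'(r,p), \\ F_p(\bar u_i)-\bar u_i, & \text{if }|\bar u_i|\le\lambda'(r,p)-\delta(r,p); \end{cases}$$ (b) if $p=1$ and $r\ge1/4$: $$\begin{cases} [T^*(g-T\bar u)]_i\in[-1/2,1/2], & |\bar u_i|\le1/2, \\ [T^*(g-T\bar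 u)]_i=\tfrac12\operatorname{sgn}\bar u_i, & 1/2<|\bar u_i|\le r-1/4, \\ [T^*(g-T\bar u)]_i=0, & |\bar u_i|>r+1/4. \end{cases}$$ If the index set $\mathcal{I}$ is finite, the theorem holds for all $p\ge1$.
   Context: For $p>1$: $F_p(t)=t+\frac p2\operatorname{sgn}(t)|t|^{p-1}$, with inverse $F_p^{-1}:\mathbb{R}\to\mathbb{R}$; $\lambda'=\lambda'(r,p)\in(r,r+\frac p2r^{p-1})$ is the unique positive value with $(F_p^{-1}(\lambda')-\lambda')^2+|F_p^{-1}(\lambda')|^p=r^p$; and $H_{(p,r)}(\lambda)=F_p^{-1}(\lambda)$ if $|\lambda|\le\lambda'$, $H_{(p,r)}(\lambda)=\lambda$ if $|\lambda|>\lambda'$. For $p=1$, $r\ge1/4$: $\lambda'(r,1)=r+1/4$ and $H_{(1,r)}(\lambda)=0$ if $|\lambda|\le1/2$, $(|\lambda|-1/2)\operatorname{sgn}\lambda$ if $1/2<|\lambda|\le r+1/4$, and $\lambda$ if $|\lambda|>r+1/4$. In all cases $\delta(r,p)=\lambda'-H_{(p,r)}(\lambda')>0$ denotes the size of the jump of $H_{(p,r)}$ at $\lambda'$. *)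

theory Defs
  imports "HOL-Analysis.Analysis"
begin

section \<open>The real Hilbert space of square-summable families\<close>

typedef 'i ell2 = "{x :: 'i \<Rightarrow> real. (\<lambda>i. (x i)\<^sup>2) summable_on UNIV}"
  morphisms coord Abs_ell2
  by (rule exI[of _ "\<lambda>_. 0"]) simp

setup_lifting type_definition_ell2

lemma ell2_eqI: "(\<And>i. coord x i = coord y i) \<Longrightarrow> x = y"
  by (metis coord_inject ext)

lemma summable_coord_square: "(\<lambda>i. (coord x i)\<^sup>2) summable_on UNIV"
  using coord[of x] by simp

lemma summable_mult_of_squares:
  fixes x y :: "'i \<Rightarrow> real"
  assumes "(\<lambda>i. (x i)\<^sup>2) summable_on UNIV" "(\<lambda>i. (y i)\<^sup>2) summable_on UNIV"
  shows "(\<lambda>i. x i * y i) summable_on UNIV"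
proof -
  have b: "norm (x i * y i) \<le> (x i)\<^sup>2 + (y i)\<^sup>2" for i
  proof -
    have "2 * (\<bar>x i\<bar> * \<bar>y i\<bar>) \<le> (x i)\<^sup>2 + (y i)\<^sup>2"
      using sum_squares_bound[of "\<bar>x i\<bar>" "\<bar>y i\<bar>"] by (simp only: power2_abs mult.assoc)
    moreover have "0 \<le> \<bar>x i\<bar> * \<bar>y i\<bar>" by (intro mult_nonneg_nonneg abs_ge_zero)
    ultimately show ?thesis unfolding real_norm_def abs_mult by linarith
  qed
  have "(\<lambda>i. norm (x i * y i)) summable_on UNIV"
    by (rule Infinite_Sum.abs_summable_on_comparison_test'[OF summable_on_add[OF assms]]) (rule b)
  then show ?thesis
    by (rule abs_summable_summable)
qed

lemma summable_coord_mult: "(\<lambda>i. coord x i * coord y i) summable_on UNIV"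
  by (intro summable_mult_of_squares summable_coord_square)

instantiation ell2 :: (type) real_vector
begin

lift_definition zero_ell2 :: "'a ell2" is "\<lambda>_. 0" by simp

lift_definition plus_ell2 :: "'a ell2 \<Rightarrow> 'a ell2 \<Rightarrow> 'a ell2" is "\<lambda>x y i. x i + y i"
proof -
  fix x y :: "'a \<Rightarrow> real"
  assume a: "(\<lambda>i. (x i)\<^sup>2) summable_on UNIV" "(\<lambda>i. (y i)\<^sup>2) summable_on UNIV"
  have "(\<lambda>i. (x i)\<^sup>2 + (y i)\<^sup>2 + 2 * (x i * y i)) summable_on UNIV"
    by (intro summable_on_add summable_on_cmult_right summable_mult_of_squares a)
  then show "(\<lambda>i. (x i + y i)\<^sup>2) summable_on UNIV"
    by (simp add: power2_sum mult.assoc)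
qed

lift_definition uminus_ell2 :: "'a ell2 \<Rightarrow> 'a ell2" is "\<lambda>x i. - x i" by simp

lift_definition scaleR_ell2 :: "real \<Rightarrow> 'a ell2 \<Rightarrow> 'a ell2" is "\<lambda>r x i. r * x i"
  by (simp add: power_mult_distrib summable_on_cmult_right)

definition minus_ell2 :: "'a ell2 \<Rightarrow> 'a ell2 \<Rightarrow> 'a ell2" where
  "minus_ell2 x y = x + - y"

instance
  by standard (unfold minus_ell2_def, (transfer; auto simp: algebra_simps fun_eq_iff)+)

end

lemma coord_zero [simp]: "coord 0 i = 0"
  by (simp only: zero_ell2.rep_eq)
lemma coord_add [simp]: "coord (x + y) i = coord x i + coord y i"
  by (simp only: plus_ell2.rep_eq)
lemma coord_uminus [simp]: "coord (- x) i = - coord x i"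
  by (simp only: uminus_ell2.rep_eq)
lemma coord_diff [simp]: "coord (x - y) i = coord x i - coord y i"
  unfolding minus_ell2_def coord_add coord_uminus by (rule add_uminus_conv_diff)
lemma coord_scaleR [simp]: "coord (r *\<^sub>R x) i = r * coord x i"
  by (simp only: scaleR_ell2.rep_eq)

instantiation ell2 :: (type) real_inner
begin

definition inner_ell2 :: "'a ell2 \<Rightarrow> 'a ell2 \<Rightarrow> real" where
  "inner_ell2 x y = (\<Sum>\<^sub>\<infinity>i. coord x i * coord y i)"

definition norm_ell2 :: "'a ell2 \<Rightarrow> real" where
  "norm_ell2 x = sqrt (inner x x)"

definition sgn_ell2 :: "'a ell2 \<Rightarrow> 'a ell2" where
  "sgn_ell2 x = x /\<^sub>R norm x"

definition dist_ell2 :: "'a ell2 \<Rightarrow> 'a ell2 \<Rightarrow> real" where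
  "dist_ell2 x y = norm (x - y)"

definition uniformity_ell2 :: "('a ell2 \<times> 'a ell2) filter" where
  "uniformity_ell2 = (INF e\<in>{0<..}. principal {(x, y). dist x y < e})"

definition open_ell2 :: "'a ell2 set \<Rightarrow> bool" where
  "open_ell2 U = (\<forall>x\<in>U. \<forall>\<^sub>F (x', y) in uniformity. x' = x \<longrightarrow> y \<in> U)"

instance
proof
  fix x y z :: "'a ell2" and r :: real and U :: "'a ell2 set"
  show "sgn x = x /\<^sub>R norm x" by (rule sgn_ell2_def)
  show "dist x y = norm (x - y)" by (rule dist_ell2_def)
  show "(uniformity :: ('a ell2 \<times> 'a ell2) filter) = (INF e\<in>{0<..}. principal {(x, y). dist x y < e})"
    by (rule uniformity_ell2_def)
  show "open U = (\<forall>x\<in>U. \<forall>\<^sub>F (x', y) in uniformity. x' = x \<longrightarrow> y \<in> U)"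
    by (rule open_ell2_def)
  show "norm x = sqrt (inner x x)" by (rule norm_ell2_def)
  show "inner x y = inner y x"
    unfolding inner_ell2_def by (intro infsum_cong mult.commute)
  have "inner (x + y) z = (\<Sum>\<^sub>\<infinity>i. coord x i * coord z i + coord y i * coord z i)"
    unfolding inner_ell2_def by (intro infsum_cong) (simp add: distrib_right)
  also have "\<dots> = inner x z + inner y z"
    unfolding inner_ell2_def by (intro infsum_add summable_coord_mult)
  finally show "inner (x + y) z = inner x z + inner y z" .
  have "inner (r *\<^sub>R x) y = (\<Sum>\<^sub>\<infinity>i. r * (coord x i * coord y i))"
    unfolding inner_ell2_def by (intro infsum_cong) (simp add: mult.assoc)
  also have "\<dots> = r * inner x y"
    unfolding inner_ell2_def by (rule infsum_cmult_right')
  finally show "inner (r *\<^sub>R x) y = r * inner x y" .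
  show "0 \<le> inner x x"
    unfolding inner_ell2_def by (intro infsum_nonneg zero_le_square)
  show "inner x x = 0 \<longleftrightarrow> x = 0"
  proof
    assume "inner x x = 0"
    then have le: "(\<Sum>\<^sub>\<infinity>i. coord x i * coord x i) \<le> 0"
      by (simp only: inner_ell2_def)
    have "coord x i * coord x i = 0" for i
      by (rule nonneg_infsum_le_0D[OF le summable_coord_mult zero_le_square UNIV_I])
    then have "coord x i = 0" for i by (metis mult_eq_0_iff)
    then show "x = 0" by (intro ell2_eqI) (simp only: coord_zero)
  qed (simp add: inner_ell2_def)
qed

end

lemma norm_ell2_square: "(norm x)\<^sup>2 = (\<Sum>\<^sub>\<infinity>i. (coord x i)\<^sup>2)" for x :: "'i ell2"
proof -
  have "(norm x)\<^sup>2 = inner x x" by (rule power2_norm_eq_inner)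
  also have "\<dots> = (\<Sum>\<^sub>\<infinity>i. coord x i * coord x i)" by (rule inner_ell2_def)
  also have "\<dots> = (\<Sum>\<^sub>\<infinity>i. (coord x i)\<^sup>2)" by (intro infsum_cong) (rule power2_eq_square[symmetric])
  finally show ?thesis .
qed

section \<open>Adjoints\<close>

text \<open>
  The library's \<^const>\<open>adjoint\<close> is a choice of a map with the adjoint property. Such a map exists
  for every bounded operator between these spaces.
\<close>

lift_definition unit_ell2 :: "'i \<Rightarrow> 'i ell2" is "\<lambda>j i. if i = j then 1 else 0 :: real"
proof -
  fix j :: 'i
  have "(\<lambda>i. (if i = j then 1 else 0 :: real)\<^sup>2) summable_on {j}" by simp
  then show "(\<lambda>i. (if i = j then 1 else 0 :: real)\<^sup>2) summable_on UNIV"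
    by (rule summable_on_cong_neutral[THEN iffD1, rotated -1]) auto
qed

lemma coord_unit_ell2 [simp]: "coord (unit_ell2 j) i = (if i = j then 1 else 0)"
  by (simp only: unit_ell2.rep_eq)

lemma coord_sum [simp]: "coord (\<Sum>j\<in>F. f j) i = (\<Sum>j\<in>F. coord (f j) i)"
  by (induction F rule: infinite_finite_induct) auto

lemma coord_finite_combination:
  assumes "finite F"
  shows "coord (\<Sum>j\<in>F. c j *\<^sub>R unit_ell2 j) i = (if i \<in> F then c i else 0)"
  using assms by (induction F rule: finite_induct) auto

lemma inner_finite_combination:
  assumes "finite F"
  shows "inner x (\<Sum>j\<in>F. c j *\<^sub>R unit_ell2 j) = (\<Sum>j\<in>F. coord x j * c j)"
proof -
  have "inner x (\<Sum>j\<in>F. c j *\<^sub>R unit_ell2 j) = (\<Sum>\<^sub>\<infinity>i. coord x i * (if i \<in> F then c i else 0))"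
    unfolding inner_ell2_def coord_finite_combination[OF assms] ..
  also have "\<dots> = (\<Sum>\<^sub>\<infinity>i\<in>F. coord x i * c i)"
    by (rule infsum_cong_neutral) auto
  finally show ?thesis using assms by simp
qed

lemma finite_sections_tendsto:
  "((\<lambda>F. \<Sum>j\<in>F. coord x j *\<^sub>R unit_ell2 j) \<longlongrightarrow> x) (finite_subsets_at_top UNIV)"
proof -
  let ?S = "\<lambda>F. \<Sum>j\<in>F. coord x j *\<^sub>R unit_ell2 j"
  have "((\<lambda>F. \<Sum>i\<in>F. (coord x i)\<^sup>2) \<longlongrightarrow> (norm x)\<^sup>2) (finite_subsets_at_top UNIV)"
    using has_sum_infsum[OF summable_coord_square[of x]]
    by (simp only: has_sum_def norm_ell2_square)
  from tendsto_diff[OF tendsto_const[of "(norm x)\<^sup>2"] this]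
  have lim: "((\<lambda>F. (norm x)\<^sup>2 - (\<Sum>i\<in>F. (coord x i)\<^sup>2)) \<longlongrightarrow> 0) (finite_subsets_at_top UNIV)"
    by (simp only: diff_self)
  have eq: "(norm (x - (\<Sum>j\<in>F. coord x j *\<^sub>R unit_ell2 j)))\<^sup>2 = (norm x)\<^sup>2 - (\<Sum>i\<in>F. (coord x i)\<^sup>2)"
    if "finite F" for F
  proof -
    let ?s = "\<Sum>j\<in>F. coord x j *\<^sub>R unit_ell2 j"
    have 1: "inner x ?s = (\<Sum>i\<in>F. (coord x i)\<^sup>2)"
      by (simp add: inner_finite_combination[OF that] power2_eq_square)
    have 2: "inner ?s ?s = (\<Sum>i\<in>F. (coord x i)\<^sup>2)"
      unfolding inner_finite_combination[OF that] coord_finite_combination[OF that]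
      by (intro sum.cong) (simp_all add: power2_eq_square)
    show ?thesis
      unfolding power2_norm_eq_inner[of "x - ?s"] inner_diff_left inner_diff_right
        inner_commute[of ?s x] 1 2 power2_norm_eq_inner[of x] by simp
  qed
  have "\<forall>\<^sub>F F in finite_subsets_at_top UNIV.
      (norm x)\<^sup>2 - (\<Sum>i\<in>F. (coord x i)\<^sup>2) = (norm (x - ?S F))\<^sup>2"
    by (intro eventually_finite_subsets_at_top_weakI eq[symmetric])
  from Lim_transform_eventually[OF lim this]
  have "((\<lambda>F. sqrt ((norm (x - ?S F))\<^sup>2)) \<longlongrightarrow> sqrt 0) (finite_subsets_at_top UNIV)"
    by (rule tendsto_real_sqrt)
  then have "((\<lambda>F. norm (x - ?S F)) \<longlongrightarrow> 0) (finite_subsets_at_top UNIV)"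
    by (simp only: real_sqrt_abs abs_norm_cancel real_sqrt_zero)
  then show ?thesis
    by (simp only: tendsto_dist_iff[of _ x] dist_norm norm_minus_commute[of _ x])
qed

lemma adjoint_ell2:
  fixes T :: "'i ell2 \<Rightarrow> 'k ell2"
  assumes "bounded_linear T"
  shows "inner (T x) y = inner x (adjoint T y)"
proof -
  interpret bounded_linear T by fact
  have "\<exists>z. \<forall>x. inner (T x) y = inner x z" for y
  proof -
    define a where "a j = inner (T (unit_ell2 j)) y" for j
    have fin: "inner (T (\<Sum>j\<in>F. c j *\<^sub>R unit_ell2 j)) y = (\<Sum>j\<in>F. c j * a j)" for F c
      by (simp add: sum scaleR inner_sum_left a_def)
    have "(\<Sum>j\<in>F. (a j)\<^sup>2) \<le> (onorm T * norm y)\<^sup>2" if F: "finite F" for F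
    proof -
      let ?s = "\<Sum>j\<in>F. a j *\<^sub>R unit_ell2 j"
      let ?S = "\<Sum>j\<in>F. (a j)\<^sup>2"
      have S0: "0 \<le> ?S" by (simp add: sum_nonneg)
      have ns: "(norm ?s)\<^sup>2 = ?S"
        unfolding power2_norm_eq_inner
        unfolding inner_finite_combination[OF F] coord_finite_combination[OF F]
        by (intro sum.cong) (simp_all add: power2_eq_square)
      have "?S = inner (T ?s) y" by (simp add: fin power2_eq_square)
      also have "\<dots> \<le> norm (T ?s) * norm y" by (rule norm_cauchy_schwarz)
      also have "\<dots> \<le> onorm T * norm ?s * norm y"
        by (intro mult_right_mono onorm assms) simp
      finally have le: "?S \<le> (onorm T * norm y) * norm ?s" by (simp add: mult_ac)
      have "(norm ?s)\<^sup>2 \<le> (onorm T * norm y) * norm ?s" using le ns by simp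
      then have "norm ?s \<le> onorm T * norm y"
        using onorm_pos_le[OF assms]
        by (cases "norm ?s = 0") (auto simp: power2_eq_square)
      then have "(norm ?s)\<^sup>2 \<le> (onorm T * norm y)\<^sup>2" by (rule power_mono) simp
      then show ?thesis using ns by simp
    qed
    then have "(\<lambda>j. (a j)\<^sup>2) summable_on UNIV"
      by (intro nonneg_bdd_above_summable_on bdd_aboveI2[where M = "(onorm T * norm y)\<^sup>2"]) auto
    then have z: "coord (Abs_ell2 a) = a" by (simp add: Abs_ell2_inverse)
    have "inner (T x) y = inner x (Abs_ell2 a)" for x
    proof -
      let ?s = "\<lambda>F. \<Sum>j\<in>F. coord x j *\<^sub>R unit_ell2 j"
      have l1: "((\<lambda>F. inner (T (?s F)) y) \<longlongrightarrow> inner (T x) y) (finite_subsets_at_top UNIV)"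
        by (intro tendsto_inner tendsto finite_sections_tendsto tendsto_const)
      have l2: "((\<lambda>F. inner (?s F) (Abs_ell2 a)) \<longlongrightarrow> inner x (Abs_ell2 a)) (finite_subsets_at_top UNIV)"
        by (intro tendsto_inner finite_sections_tendsto tendsto_const)
      have "inner (T (?s F)) y = inner (?s F) (Abs_ell2 a)" if "finite F" for F
        by (simp add: fin inner_commute[of _ "Abs_ell2 a"] inner_finite_combination[OF that] z mult.commute)
      then have "\<forall>\<^sub>F F in finite_subsets_at_top UNIV. inner (T (?s F)) y = inner (?s F) (Abs_ell2 a)"
        by (intro eventually_finite_subsets_at_top_weakI) auto
      with l1 have "((\<lambda>F. inner (?s F) (Abs_ell2 a)) \<longlongrightarrow> inner (T x) y) (finite_subsets_at_top UNIV)"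
        using tendsto_cong by fastforce
      then show ?thesis using l2 tendsto_unique[OF finite_subsets_at_top_neq_bot] by blast
    qed
    then show ?thesis by blast
  qed
  then have "\<exists>f'. \<forall>x y. inner (T x) y = inner x (f' y)" by metis
  then show ?thesis unfolding adjoint_def by (rule someI2_ex) blast
qed

section \<open>Weak convergence\<close>

definition weakly_convergent_to :: "(nat \<Rightarrow> 'a::real_normed_vector) \<Rightarrow> 'a \<Rightarrow> bool" where
  "weakly_convergent_to u l \<longleftrightarrow>
     (\<forall>\<phi> :: 'a \<Rightarrow> real. bounded_linear \<phi> \<longrightarrow> (\<lambda>n. \<phi> (u n)) \<longlonglongrightarrow> \<phi> l)"

section \<open>The thresholding functions\<close>

definition Fp :: "real \<Rightarrow> real \<Rightarrow> real" where
  "Fp p t = t + p / 2 * sgn t * \<bar>t\<bar> powr (p - 1)"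

definition Fp_inv :: "real \<Rightarrow> real \<Rightarrow> real" where
  "Fp_inv p = inv (Fp p)"

text \<open>The branch for exponent 1 of the next two definitions is meant for \<open>r \<ge> 1/4\<close> only.\<close>

definition lam :: "real \<Rightarrow> real \<Rightarrow> real" where
  "lam r p = (if p = 1 then r + 1/4
     else (THE l. 0 < l \<and> (Fp_inv p l - l)\<^sup>2 + \<bar>Fp_inv p l\<bar> powr p = r powr p))"

definition H :: "real \<Rightarrow> real \<Rightarrow> real \<Rightarrow> real" where
  "H p r t =
     (if p = 1 then
        (if \<bar>t\<bar> \<le> 1/2 then 0
         else if \<bar>t\<bar> \<le> r + 1/4 then (\<bar>t\<bar> - 1/2) * sgn t
         else t)
      else
        (if \<bar>t\<bar> \<le> lam r p then Fp_inv p t else t))"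

definition jump :: "real \<Rightarrow> real \<Rightarrow> real" where
  "jump r p = lam r p - H p r (lam r p)"

lemma Fp_bij:
  assumes "p > 1"
  shows "bij (Fp p)"
proof -
  have neg: "Fp p (- t) = - Fp p t" for t by (simp add: Fp_def sgn_minus)
  have mono0: "Fp p s < Fp p t" if "0 \<le> s" "s < t" for s t
  proof -
    have "s powr (p - 1) \<le> t powr (p - 1)" using that assms by (intro powr_mono2) auto
    then have "p / 2 * s powr (p - 1) \<le> p / 2 * t powr (p - 1)" using assms by simp
    moreover have "Fp p x = x + p / 2 * x powr (p - 1)" if "0 \<le> x" for x
      using that by (cases "x = 0") (auto simp: Fp_def)
    ultimately show ?thesis using that by simp
  qed
  have pos: "0 \<le> Fp p t" if "0 \<le> t" for t
    using that assms by (simp add: Fp_def)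
  have "strict_mono (Fp p)"
  proof
    fix s t :: real
    assume "s < t"
    consider "0 \<le> s" | "t \<le> 0" | "s < 0" "0 < t" by linarith
    then show "Fp p s < Fp p t"
    proof cases
      case 1 then show ?thesis using mono0 \<open>s < t\<close> by blast
    next
      case 2 then show ?thesis using mono0[of "- t" "- s"] \<open>s < t\<close> neg by simp
    next
      case 3
      have "Fp p s \<le> 0" using pos[of "- s"] neg[of s] 3 by simp
      moreover have "0 < Fp p t" using mono0[of 0 t] 3 by (simp add: Fp_def)
      ultimately show ?thesis by linarith
    qed
  qed
  then have "inj (Fp p)" by (rule strict_mono_imp_inj_on)
  moreover have surj0: "\<exists>x. Fp p x = y" if "0 \<le> y" for y
  proof -
    have "continuous_on {0..y} (\<lambda>t. t + p / 2 * t powr (p - 1))"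
      using assms by (intro continuous_intros continuous_on_powr') auto
    moreover have "t + p / 2 * t powr (p - 1) = Fp p t" if "t \<in> {0..y}" for t
      using that by (cases "t = 0") (auto simp: Fp_def)
    ultimately have c: "continuous_on {0..y} (Fp p)" by (metis (no_types, lifting) continuous_on_cong)
    have "Fp p 0 \<le> y" "y \<le> Fp p y" using that assms by (auto simp: Fp_def)
    from IVT'[OF this \<open>0 \<le> y\<close> c] show ?thesis by blast
  qed
  have "surj (Fp p)"
  proof (unfold surj_def, intro allI)
    fix y
    have "\<exists>x. Fp p x = y"
    proof (cases "0 \<le> y")
      case False
      then obtain x where "Fp p x = - y" using surj0[of "- y"] by auto
      then have "Fp p (- x) = y" using neg by simp
      then show ?thesis ..
    qed (rule surj0)
    then show "\<exists>x. y = Fp p x" by metis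
  qed
  ultimately show ?thesis by (simp add: bij_def)
qed

lemma Fp_Fp_inv: "p > 1 \<Longrightarrow> Fp p (Fp_inv p t) = t"
  unfolding Fp_inv_def by (simp add: Fp_bij bij_is_surj surj_f_inv_f)

lemma Fp_inv_Fp: "p > 1 \<Longrightarrow> Fp_inv p (Fp p s) = s"
  unfolding Fp_inv_def by (simp add: Fp_bij bij_is_inj)

lemma lam_well_defined:
  assumes p: "p > 1" and r: "r > 0"
  shows "\<exists>!l. 0 < l \<and> (Fp_inv p l - l)\<^sup>2 + \<bar>Fp_inv p l\<bar> powr p = r powr p"
proof -
  define E where "E s = (p / 2 * s powr (p - 1))\<^sup>2 + s powr p" for s
  have Fpos: "0 < Fp p s \<longleftrightarrow> 0 < s" for s
  proof -
    have "0 \<le> p / 2 * \<bar>s\<bar> powr (p - 1)" using p by simp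
    then show ?thesis by (cases s "0::real" rule: linorder_cases) (auto simp: Fp_def)
  qed
  have E: "(s - Fp p s)\<^sup>2 + \<bar>s\<bar> powr p = E s" if "0 < s" for s
    using that by (simp add: Fp_def E_def power2_commute)
  have mono: "E s < E t" if "0 < s" "s < t" for s t
  proof -
    have "s powr (p - 1) \<le> t powr (p - 1)" using that p by (intro powr_mono2) auto
    then have "(p / 2 * s powr (p - 1))\<^sup>2 \<le> (p / 2 * t powr (p - 1))\<^sup>2"
      using p by (intro power_mono mult_left_mono) auto
    moreover have "s powr p < t powr p" using that p by (intro powr_less_mono2) auto
    ultimately show ?thesis unfolding E_def by linarith
  qed
  have "continuous_on {0..r} E"
    unfolding E_def using p by (intro continuous_intros continuous_on_powr') auto
  moreover have "E 0 \<le> r powr p" "r powr p \<le> E r"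
    using p by (auto simp: E_def)
  ultimately obtain s where s: "0 \<le> s" "E s = r powr p"
    using IVT'[of E 0 "r powr p" r] r by auto
  have "0 < r powr p" using r by simp
  then have s0: "0 < s" using s p by (cases "s = 0") (auto simp: E_def)
  show ?thesis
  proof (rule ex1I[of _ "Fp p s"])
    show "0 < Fp p s \<and> (Fp_inv p (Fp p s) - Fp p s)\<^sup>2 + \<bar>Fp_inv p (Fp p s)\<bar> powr p = r powr p"
      using Fpos[of s] s0 E[OF s0] s(2) by (simp only: Fp_inv_Fp[OF p])
  next
    fix l
    assume l: "0 < l \<and> (Fp_inv p l - l)\<^sup>2 + \<bar>Fp_inv p l\<bar> powr p = r powr p"
    define t where "t = Fp_inv p l"
    have lt: "l = Fp p t" unfolding t_def by (rule Fp_Fp_inv[OF p, symmetric])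
    have t0: "0 < t" using l Fpos[of t] lt by blast
    have "E t = r powr p" using E[OF t0] l unfolding lt Fp_inv_Fp[OF p] by linarith
    then have "t = s" using mono[of s t] mono[of t s] s0 t0 s(2) by (metis linorder_less_linear less_irrefl)
    then show "l = Fp p s" using lt by simp
  qed
qed

lemma abs_le_abs_Fp:
  assumes "p > 1"
  shows "\<bar>s\<bar> \<le> \<bar>Fp p s\<bar>"
proof -
  have "0 \<le> p / 2 * \<bar>s\<bar> powr (p - 1)" using assms by simp
  then show ?thesis by (cases s "0::real" rule: linorder_cases) (auto simp: Fp_def)
qed

lemma abs_H_le:
  assumes "p \<ge> 1"
  shows "\<bar>H p r t\<bar> \<le> \<bar>t\<bar>"
proof (cases "p = 1")
  case True
  then show ?thesis by (auto simp: H_def abs_mult abs_sgn_eq)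
next
  case False
  with assms have "p > 1" by simp
  then show ?thesis using abs_le_abs_Fp[of p "Fp_inv p t"] Fp_Fp_inv[of p t] by (auto simp: H_def)
qed

section \<open>The functional and the iteration\<close>

definition J ::
  "('i ell2 \<Rightarrow> 'k ell2) \<Rightarrow> 'k ell2 \<Rightarrow> real \<Rightarrow> real \<Rightarrow> 'i ell2 \<Rightarrow> ennreal" where
  "J T g p r u =
     ennreal ((norm (T u - g))\<^sup>2)
     + (\<Sum>\<^sub>\<infinity>i. ennreal (min (\<bar>coord u i\<bar> powr p) (r powr p)))"

definition HH ::
  "('i ell2 \<Rightarrow> 'k ell2) \<Rightarrow> 'k ell2 \<Rightarrow> real \<Rightarrow> real \<Rightarrow> 'i ell2 \<Rightarrow> 'i ell2" where
  "HH T g p r u =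
     Abs_ell2 (\<lambda>i. H p r (coord (u - adjoint T (T u) + adjoint T g) i))"

lemma coord_HH:
  assumes "p \<ge> 1"
  shows "coord (HH T g p r u) i = H p r (coord (u - adjoint T (T u) + adjoint T g) i)"
proof -
  let ?v = "u - adjoint T (T u) + adjoint T g"
  have "(H p r t)\<^sup>2 \<le> t\<^sup>2" for t
    using abs_H_le[OF assms] by (simp only: abs_le_square_iff)
  then have "(\<lambda>i. (H p r (coord ?v i))\<^sup>2) summable_on UNIV"
    by (intro summable_on_comparison_test[OF summable_coord_square[of ?v]]) (assumption | rule zero_le_power2)+
  then show ?thesis unfolding HH_def by (subst Abs_ell2_inverse) auto
qed

end

(*
  The iterates minimise, step by step, a surrogate of the functional in which the coordinates
  decouple, so the energy decreases and the steps tend to 0. As the thresholding function jumps,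
  short steps force the finite set of coordinates above the threshold to be eventually constant.
  From then on the iteration is a nonexpansive map: the identity or a proximal map of |.|^p in each
  coordinate, after a Landweber step. The iterates stay bounded: below the threshold by the energy;
  above it because their component in the kernel of T is constant while T controls the rest. Opial's
  argument then gives weak convergence to a fixed point of the nonexpansive map.
*)

theory Submission
  imports Defs
begin

section \<open>Scalar thresholding\<close>

text \<open>The obstacle is that the penalty is neither convex nor coercive: it stops growing at
  \<open>r\<close>, so the energy says nothing about the size of a large coordinate. Small
  coordinates have a uniform square sum because t^2 = t^(2-p) t^p is at most r^(2-p) t^p when p is
  at most 2; for larger p a finite index set replaces this. Large coordinates are finite in number,
  and on finitely many coordinates \<open>T\<close> is bounded below on the complement of its
  kernel, even if the range of \<open>T\<close> is not closed. The threshold is the point where the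
  minimum over t of (t - x)^2 + |t|^p reaches the saturated penalty r^p. Beyond it, leaving x
  unchanged is cheaper, so the minimiser of the truncated scalar problem jumps. The strict bound on
  the norm of \<open>T\<close> leaves a fixed fraction of each squared step in the energy decrease,
  which makes the steps vanish. The cases p = 1 and p > 1 differ only in the proximal map; the
  locale \<open>jump_threshold\<close> collects what both provide.\<close>

lemma powr_abs_subgradient:
  fixes p s t :: real
  assumes p: "p > 1"
  shows "\<bar>s\<bar> powr p + p * sgn s * \<bar>s\<bar> powr (p - 1) * (t - s) \<le> \<bar>t\<bar> powr p"
proof -
  define b where "b = \<bar>s\<bar> powr (p - 1)"
  have b0: "0 \<le> b" by (simp add: b_def)
  have bq: "b powr (p / (p - 1)) = \<bar>s\<bar> powr p"
    using p by (simp add: b_def powr_powr)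
  have bs: "b * \<bar>s\<bar> = \<bar>s\<bar> powr p"
    using p by (simp add: b_def powr_mult_base mult.commute)
  \<comment> \<open>Young's inequality for the conjugate exponents \<open>p\<close> and
    \<open>p / (p - 1)\<close> yields the convexity estimate without derivatives, so the origin
    needs no separate case.\<close>
  have "\<bar>t\<bar> * b \<le> \<bar>t\<bar> powr p / p + b powr (p / (p - 1)) / (p / (p - 1))"
    by (rule Youngs_inequality) (use p b0 in \<open>auto simp: field_simps\<close>)
  then have "p * (\<bar>t\<bar> * b) \<le> p * (\<bar>t\<bar> powr p / p + \<bar>s\<bar> powr p / (p / (p - 1)))"
    using p bq by simp
  also have "\<dots> = \<bar>t\<bar> powr p + (p - 1) * \<bar>s\<bar> powr p"
    using p by (simp add: field_simps)
  finally have 1: "p * (\<bar>t\<bar> * b) \<le> \<bar>t\<bar> powr p + (p - 1) * \<bar>s\<bar> powr p" .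
  have "sgn s * t \<le> \<bar>t\<bar>" by (auto simp: sgn_if)
  then have 2: "p * b * (sgn s * t) \<le> p * b * \<bar>t\<bar>"
    using p b0 by (intro mult_left_mono) auto
  have "p * sgn s * b * (t - s) = p * b * (sgn s * t) - p * (b * \<bar>s\<bar>)"
    by (simp add: algebra_simps abs_sgn)
  also have "\<dots> \<le> p * (\<bar>t\<bar> * b) - p * \<bar>s\<bar> powr p"
    using 2 unfolding bs by (simp only: mult_ac)
  also have "\<dots> \<le> \<bar>t\<bar> powr p - \<bar>s\<bar> powr p"
    using 1 by (simp add: algebra_simps)
  finally show ?thesis unfolding b_def by linarith
qed

text \<open>\<open>h_min\<close> says that \<open>h\<close> is the proximal map of
  \<open>\<bar>t\<bar> powr p\<close>; the extra \<open>(t - h x)\<^sup>2\<close> is the quadratic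
  growth of a strongly convex objective at its minimiser. \<open>h_l\<close> says that the minimal
  value at \<open>l\<close> is the saturated penalty.\<close>

locale jump_threshold =
  fixes p r l :: real and h :: "real \<Rightarrow> real"
  assumes p1: "p \<ge> 1" and r0: "r > 0" and l0: "l > 0"
    and h_min: "(h x - x)\<^sup>2 + \<bar>h x\<bar> powr p + (t - h x)\<^sup>2 \<le> (t - x)\<^sup>2 + \<bar>t\<bar> powr p"
    and h_l: "(h l - l)\<^sup>2 + \<bar>h l\<bar> powr p = r powr p"
begin

text \<open>Each of \<open>h x\<close>, \<open>h y\<close> competes in the other's problem; adding
  the two inequalities cancels the penalties and leaves firm nonexpansiveness.\<close>

lemma h_firm: "(h x - h y)\<^sup>2 \<le> (x - y) * (h x - h y)"
  using h_min[of x "h y"] h_min[of y "h x"]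
  by (simp add: power2_eq_square algebra_simps)

lemma h_lipschitz: "\<bar>h x - h y\<bar> \<le> \<bar>x - y\<bar>"
proof (cases "h x = h y")
  case False
  have "\<bar>h x - h y\<bar> * \<bar>h x - h y\<bar> \<le> \<bar>x - y\<bar> * \<bar>h x - h y\<bar>"
    using h_firm[of x y] abs_ge_self[of "(x - y) * (h x - h y)"]
    by (simp add: power2_eq_square abs_mult)
  with False show ?thesis by (meson mult_right_le_imp_le zero_less_abs_iff right_minus_eq)
qed simp

lemma h_mono: "x \<le> y \<Longrightarrow> h x \<le> h y"
proof -
  assume "x \<le> y"
  show ?thesis
  proof (rule ccontr)
    assume "\<not> h x \<le> h y"
    then have "0 < (h x - h y)\<^sup>2" and "(x - y) * (h x - h y) \<le> 0"
      using \<open>x \<le> y\<close> by (auto intro: mult_nonpos_nonneg)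
    then show False using h_firm[of x y] by linarith
  qed
qed

lemma h_0 [simp]: "h 0 = 0"
proof -
  have "2 * (h 0)\<^sup>2 + \<bar>h 0\<bar> powr p \<le> 0" using h_min[of 0 0] p1 by simp
  moreover have "0 \<le> \<bar>h 0\<bar> powr p" "0 \<le> (h 0)\<^sup>2" by simp_all
  ultimately have "(h 0)\<^sup>2 \<le> 0" by linarith
  then show ?thesis by simp
qed

text \<open>The objective is even under a joint reflection, so the reflected minimiser competes, and
  quadratic growth forces equality.\<close>

lemma h_minus: "h (- x) = - h x"
proof -
  have "(- h x - x)\<^sup>2 = (h x - - x)\<^sup>2" "(h (- x) - - x)\<^sup>2 = (- h (- x) - x)\<^sup>2"
    "(- h x - h (- x))\<^sup>2 = (h x + h (- x))\<^sup>2" "(- h (- x) - h x)\<^sup>2 = (h x + h (- x))\<^sup>2"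
    "(- h x - - x)\<^sup>2 = (h x - x)\<^sup>2"
    by (simp_all add: power2_eq_square algebra_simps)
  then have "(h x + h (- x))\<^sup>2 \<le> 0"
    using h_min[of x "- h (- x)"] h_min[of "- x" "- h x"] unfolding abs_minus_cancel by linarith
  then show ?thesis by simp
qed

lemma abs_h: "\<bar>h x\<bar> = h \<bar>x\<bar>"
  using h_mono[of 0 x] h_mono[of x 0] h_minus[of x] by (auto simp: abs_if)

lemma h_l_nonneg: "0 \<le> h l"
  using h_mono[of 0 l] l0 by simp

lemma h_l_le_r: "h l \<le> r"
proof -
  have "\<bar>h l\<bar> powr p \<le> r powr p" using h_l zero_le_power2[of "h l - l"] by linarith
  then show ?thesis using h_l_nonneg p1 r0 powr_less_mono2[of p r "h l"] by force
qed

text \<open>If \<open>l\<close> were its own proximal point, the competitor 0 would force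
  \<open>l powr p\<close> to vanish. This makes the jump nontrivial.\<close>

lemma h_l_neq: "h l \<noteq> l"
proof
  assume eq: "h l = l"
  then have "l powr p = r powr p" using h_l l0 by simp
  moreover have "l powr p \<le> 0" using h_min[of l 0] eq l0 p1 by simp
  ultimately show False using r0 by simp
qed

text \<open>The competitor \<open>l\<close> in its own problem has no quadratic cost, so
  \<open>l powr p\<close> exceeds \<open>r powr p\<close> by at least the squared jump.\<close>

lemma r_less_l: "r < l"
proof (rule ccontr)
  assume "\<not> r < l"
  then have "l powr p \<le> r powr p" using l0 p1 by (intro powr_mono2) auto
  moreover have "r powr p + (l - h l)\<^sup>2 \<le> l powr p"
    using h_min[of l l] h_l l0 by simp
  moreover have "0 < (l - h l)\<^sup>2" using h_l_neq by simp
  ultimately show False by linarith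
qed

text \<open>The Moreau envelope of \<open>|\<cdot>|\<^sup>p\<close> is monotone because scaling the minimiser at \<open>y\<close> by \<open>x/y\<close>
  gives an admissible competitor at \<open>x\<close>.\<close>

lemma envelope_mono:
  assumes "0 \<le> x" "x \<le> y"
  shows "(h x - x)\<^sup>2 + \<bar>h x\<bar> powr p \<le> (h y - y)\<^sup>2 + \<bar>h y\<bar> powr p"
proof (cases "x = 0")
  case True
  then show ?thesis using p1 by simp
next
  case False
  define c where "c = x / y"
  have y: "y > 0" using False assms by simp
  have c: "0 \<le> c" "c \<le> 1" "x = c * y" using False assms y by (auto simp: c_def)
  have c1: "c\<^sup>2 \<le> 1" using c by (simp add: power_le_one)
  have c2: "c powr p \<le> 1" using c p1 by (intro powr_le1) auto
  have "(h x - x)\<^sup>2 + \<bar>h x\<bar> powr p \<le> (c * h y - x)\<^sup>2 + \<bar>c * h y\<bar> powr p"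
    using h_min[of x "c * h y"] zero_le_power2[of "c * h y - h x"] by linarith
  also have "\<dots> = c\<^sup>2 * (h y - y)\<^sup>2 + c powr p * \<bar>h y\<bar> powr p"
    using c by (simp add: abs_mult powr_mult power2_eq_square algebra_simps)
  also have "\<dots> \<le> 1 * (h y - y)\<^sup>2 + 1 * \<bar>h y\<bar> powr p"
    by (intro add_mono mult_right_mono c1 c2) auto
  finally show ?thesis by simp
qed

lemma envelope_abs: "(h x - x)\<^sup>2 + \<bar>h x\<bar> powr p = (h \<bar>x\<bar> - \<bar>x\<bar>)\<^sup>2 + \<bar>h \<bar>x\<bar>\<bar> powr p"
  by (cases "0 \<le> x") (simp_all add: h_minus power2_eq_square algebra_simps)

definition cut :: "real \<Rightarrow> real" where
  "cut x = (if \<bar>x\<bar> \<le> l then h x else x)"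

text \<open>The truncated minimum is the smaller of the Moreau envelope, attained at
  \<open>h x\<close>, and \<open>r powr p\<close>, attained at \<open>x\<close>. By monotonicity of
  the envelope the order of the two changes at \<open>l\<close>, where they tie.\<close>

lemma cut_minimizes:
  "(cut x - x)\<^sup>2 + min (\<bar>cut x\<bar> powr p) (r powr p) \<le> (t - x)\<^sup>2 + min (\<bar>t\<bar> powr p) (r powr p)"
proof (cases "\<bar>x\<bar> \<le> l")
  case True
  have "(h x - x)\<^sup>2 + \<bar>h x\<bar> powr p \<le> r powr p"
    using envelope_mono[of "\<bar>x\<bar>" l] True h_l envelope_abs[of x] by simp
  moreover have "(h x - x)\<^sup>2 + \<bar>h x\<bar> powr p \<le> (t - x)\<^sup>2 + \<bar>t\<bar> powr p"
    using h_min[of x t] zero_le_power2[of "t - h x"] by linarith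
  moreover have "cut x = h x" using True by (simp add: cut_def)
  ultimately show ?thesis using zero_le_power2[of "t - x"] unfolding min_def by (smt (verit))
next
  case False
  have "r powr p \<le> (h x - x)\<^sup>2 + \<bar>h x\<bar> powr p"
    using envelope_mono[of l "\<bar>x\<bar>"] False l0 h_l envelope_abs[of x] by simp
  moreover have "(h x - x)\<^sup>2 + \<bar>h x\<bar> powr p \<le> (t - x)\<^sup>2 + \<bar>t\<bar> powr p"
    using h_min[of x t] zero_le_power2[of "t - h x"] by linarith
  moreover have "cut x = x" using False by (simp add: cut_def)
  ultimately show ?thesis using zero_le_power2[of "t - x"] unfolding min_def by (smt (verit) diff_self power_zero_numeral)
qed

text \<open>The range of \<open>cut\<close> omits the gap between \<open>h l\<close> and
  \<open>l\<close>, so the output alone reveals which branch was taken.\<close>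

lemma abs_cut_gt_iff: "l < \<bar>cut x\<bar> \<longleftrightarrow> l < \<bar>x\<bar>"
  using h_mono[of "\<bar>x\<bar>" l] h_l_le_r r_less_l by (auto simp: cut_def abs_h)

lemma abs_cut_le: "\<bar>x\<bar> \<le> l \<Longrightarrow> \<bar>cut x\<bar> \<le> h l"
  using h_mono[of "\<bar>x\<bar>" l] by (simp add: cut_def abs_h)

lemma tendsto_h:
  assumes "f \<longlonglongrightarrow> x"
  shows "(\<lambda>n. h (f n)) \<longlonglongrightarrow> h x"
proof (rule metric_tendsto_imp_tendsto[OF assms])
  show "\<forall>\<^sub>F n in sequentially. dist (h (f n)) (h x) \<le> dist (f n) x"
    using h_lipschitz by (simp add: dist_real_def)
qed

end

text \<open>\<open>Fp p s = x\<close> is the stationarity equation of (t - x)^2 + |t|^p at s.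
  Expanding the square around s turns its cross term into the subgradient of the penalty.\<close>

lemma jump_threshold_Fp_inv:
  assumes p: "p > 1" and r: "r > 0"
  shows "jump_threshold p r (lam r p) (Fp_inv p)"
proof
  have "0 < lam r p \<and> (Fp_inv p (lam r p) - lam r p)\<^sup>2 + \<bar>Fp_inv p (lam r p)\<bar> powr p = r powr p"
    using theI'[OF lam_well_defined[OF p r]] p by (simp add: lam_def)
  then show "0 < lam r p"
    "(Fp_inv p (lam r p) - lam r p)\<^sup>2 + \<bar>Fp_inv p (lam r p)\<bar> powr p = r powr p" by auto
  fix x t
  define s where "s = Fp_inv p x"
  have x: "x = s + p / 2 * sgn s * \<bar>s\<bar> powr (p - 1)"
    using Fp_Fp_inv[OF p, of x] by (simp add: s_def Fp_def)
  have "(t - x)\<^sup>2 = (s - x)\<^sup>2 + (t - s)\<^sup>2 - 2 * (x - s) * (t - s)"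
    by (simp add: power2_eq_square algebra_simps)
  also have "2 * (x - s) = p * sgn s * \<bar>s\<bar> powr (p - 1)" by (simp add: x)
  finally show "(Fp_inv p x - x)\<^sup>2 + \<bar>Fp_inv p x\<bar> powr p + (t - Fp_inv p x)\<^sup>2 \<le> (t - x)\<^sup>2 + \<bar>t\<bar> powr p"
    using powr_abs_subgradient[OF p, of s t] unfolding s_def[symmetric] by linarith
qed (use p r in auto)

definition soft_threshold :: "real \<Rightarrow> real" where
  "soft_threshold x = (if \<bar>x\<bar> \<le> 1/2 then 0 else (\<bar>x\<bar> - 1/2) * sgn x)"

lemma jump_threshold_soft:
  assumes r: "r \<ge> 1/4"
  shows "jump_threshold 1 r (lam r 1) soft_threshold"
proof
  show "0 < lam r 1" using r by (simp add: lam_def)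
  show "(soft_threshold (lam r 1) - lam r 1)\<^sup>2 + \<bar>soft_threshold (lam r 1)\<bar> powr 1 = r powr 1"
  proof -
    \<comment> \<open>The bound on \<open>r\<close> puts \<open>r + 1/4\<close> at or beyond the
      kink 1/2; the envelope there is (1/2)^2 + (r - 1/4) = r.\<close>
    have "soft_threshold (r + 1/4) = r - 1/4" using r by (auto simp: soft_threshold_def)
    then show ?thesis using r by (simp add: lam_def power2_eq_square)
  qed
  fix x t :: real
  \<comment> \<open>\<open>2 * (x - soft_threshold x)\<close> is a subgradient of the absolute value
    at \<open>soft_threshold x\<close>.\<close>
  have "\<bar>soft_threshold x\<bar> + 2 * (x - soft_threshold x) * (t - soft_threshold x) \<le> \<bar>t\<bar>"
  proof (cases "\<bar>x\<bar> \<le> 1/2")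
    case True
    then have "\<bar>2 * x\<bar> * \<bar>t\<bar> \<le> 1 * \<bar>t\<bar>" by (intro mult_right_mono) auto
    then have "2 * x * t \<le> \<bar>t\<bar>" using abs_ge_self[of "2 * x * t"] unfolding abs_mult by linarith
    with True show ?thesis by (simp add: soft_threshold_def)
  next
    case False
    then show ?thesis by (auto simp: soft_threshold_def sgn_if abs_if algebra_simps split: if_splits)
  qed
  moreover have "(t - x)\<^sup>2 = (soft_threshold x - x)\<^sup>2 + (t - soft_threshold x)\<^sup>2 - 2 * (x - soft_threshold x) * (t - soft_threshold x)"
    by (simp add: power2_eq_square algebra_simps)
  ultimately show "(soft_threshold x - x)\<^sup>2 + \<bar>soft_threshold x\<bar> powr 1 + (t - soft_threshold x)\<^sup>2 \<le> (t - x)\<^sup>2 + \<bar>t\<bar> powr 1"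
    by simp
qed (use r in auto)

lemma H_eq_cut:
  assumes "p > 1" "r > 0"
  shows "H p r = jump_threshold.cut (lam r p) (Fp_inv p)"
  using assms by (simp add: fun_eq_iff H_def jump_threshold.cut_def[OF jump_threshold_Fp_inv[OF assms]])

lemma H_eq_cut_soft:
  assumes "r \<ge> 1/4"
  shows "H 1 r = jump_threshold.cut (lam r 1) soft_threshold"
  unfolding jump_threshold.cut_def[OF jump_threshold_soft[OF assms]]
  using assms by (auto simp: fun_eq_iff H_def soft_threshold_def lam_def)

section \<open>Sequences and operators in the sequence space\<close>

lemma inner_unit_ell2 [simp]: "inner x (unit_ell2 i) = coord x i"
  using inner_finite_combination[of "{i}" x "\<lambda>_. 1"] by simp

lemma abs_coord_le_norm: "\<bar>coord x i\<bar> \<le> norm x"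
proof -
  have "norm (unit_ell2 i) = 1" by (simp add: norm_eq_sqrt_inner)
  then show ?thesis using Cauchy_Schwarz_ineq2[of x "unit_ell2 i"] by simp
qed

lemma sum_coord_square_le: "finite F \<Longrightarrow> (\<Sum>i\<in>F. (coord x i)\<^sup>2) \<le> (norm x)\<^sup>2"
  unfolding norm_ell2_square
  by (intro finite_sum_le_infsum summable_coord_square) auto

lemma finite_large_coords: "c > 0 \<Longrightarrow> finite {i. c < \<bar>coord x i\<bar>}"
proof (rule ccontr)
  assume c: "c > 0" and inf: "infinite {i. c < \<bar>coord x i\<bar>}"
  obtain n :: nat where n: "(norm x)\<^sup>2 / c\<^sup>2 < n" using reals_Archimedean2 by blast
  obtain F where F: "F \<subseteq> {i. c < \<bar>coord x i\<bar>}" "finite F" "card F = n"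
    using infinite_arbitrarily_large[OF inf] by blast
  have "real n * c\<^sup>2 = (\<Sum>i\<in>F. c\<^sup>2)" using F by simp
  also have "\<dots> \<le> (\<Sum>i\<in>F. (coord x i)\<^sup>2)"
    using F c by (intro sum_mono) (auto simp: abs_le_square_iff[symmetric])
  also have "\<dots> \<le> (norm x)\<^sup>2" by (rule sum_coord_square_le[OF F(2)])
  finally show False using n c by (simp add: field_simps)
qed

section \<open>Weak convergence through coordinates\<close>

lemma riesz_ell2:
  fixes \<phi> :: "'i ell2 \<Rightarrow> real"
  assumes "bounded_linear \<phi>"
  shows "\<exists>z. \<forall>x. \<phi> x = inner x z"
proof -
  \<comment> \<open>Over the unit type the sequence space is one-dimensional, so the functional
    becomes an operator whose adjoint supplies the representing vector.\<close>
  let ?T = "\<lambda>x. \<phi> x *\<^sub>R unit_ell2 ()"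
  have "bounded_linear ?T" by (rule bounded_linear_scaleR_const[OF assms])
  then have "\<phi> x = inner x (adjoint ?T (unit_ell2 ()))" for x
    by (subst adjoint_ell2[symmetric]) simp_all
  then show ?thesis by blast
qed

lemma weakly_convergent_to_coordI:
  fixes u :: "nat \<Rightarrow> 'i ell2"
  assumes bdd: "\<And>n. norm (u n) \<le> M"
    and lim: "\<And>i. (\<lambda>n. coord (u n) i) \<longlonglongrightarrow> coord l i"
  shows "weakly_convergent_to u l"
  unfolding weakly_convergent_to_def
proof (intro allI impI)
  fix \<phi> :: "'i ell2 \<Rightarrow> real"
  assume "bounded_linear \<phi>"
  then obtain z where z: "\<And>x. \<phi> x = inner x z"
    using riesz_ell2[of \<phi>] by blast
  \<comment> \<open>\<open>K\<close> bounds \<open>norm (u n - l)\<close>; the summand 1 keeps it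
    positive for the division below.\<close>
  define K where "K = M + norm l + 1"
  have K: "K > 0" using order_trans[OF norm_ge_zero bdd[of 0]] norm_ge_zero[of l] unfolding K_def by linarith
  show "(\<lambda>n. \<phi> (u n)) \<longlonglongrightarrow> \<phi> l"
  proof (rule LIMSEQ_I)
    fix e :: real
    assume e: "e > 0"
    let ?s = "\<lambda>F. \<Sum>j\<in>F. coord z j *\<^sub>R unit_ell2 j"
    have "\<forall>\<^sub>F F in finite_subsets_at_top UNIV. dist (?s F) z < e / (2 * K)"
      using e K by (intro tendstoD finite_sections_tendsto) auto
    moreover have "\<forall>\<^sub>F F in finite_subsets_at_top (UNIV :: 'i set). finite F"
      by (rule eventually_finite_subsets_at_top_weakI)
    ultimately have "\<forall>\<^sub>F F in finite_subsets_at_top UNIV. finite F \<and> dist (?s F) z < e / (2 * K)"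
      by (auto elim: eventually_elim2)
    then obtain F where F: "finite F" "dist (?s F) z < e / (2 * K)"
      using eventually_happens'[OF finite_subsets_at_top_neq_bot] by blast
    have "(\<lambda>n. \<Sum>j\<in>F. coord (u n) j * coord z j) \<longlonglongrightarrow> (\<Sum>j\<in>F. coord l j * coord z j)"
      by (intro tendsto_intros lim)
    then have "(\<lambda>n. inner (u n) (?s F)) \<longlonglongrightarrow> inner l (?s F)"
      by (simp only: inner_finite_combination[OF F(1)])
    then obtain N where N: "\<And>n. n \<ge> N \<Longrightarrow> norm (inner (u n) (?s F) - inner l (?s F)) < e / 2"
      using LIMSEQ_D[of "\<lambda>n. inner (u n) (?s F)" "inner l (?s F)" "e/2"] e by auto
    have "norm (\<phi> (u n) - \<phi> l) < e" if "n \<ge> N" for n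
    proof -
      have "norm (u n - l) \<le> K"
        using norm_triangle_ineq4[of "u n" l] bdd[of n] by (simp add: K_def)
      then have "norm (u n - l) * norm (z - ?s F) \<le> K * (e / (2 * K))"
        using F(2) K by (intro mult_mono) (auto simp: dist_norm norm_minus_commute)
      then have "\<bar>inner (u n - l) (z - ?s F)\<bar> \<le> e / 2"
        using Cauchy_Schwarz_ineq2[of "u n - l" "z - ?s F"] K by simp
      moreover have "\<phi> (u n) - \<phi> l = inner (u n - l) (z - ?s F) + (inner (u n) (?s F) - inner l (?s F))"
        unfolding z by (simp add: inner_diff_left inner_diff_right)
      ultimately show ?thesis using N[OF that] unfolding real_norm_def by linarith
    qed
    then show "\<exists>N. \<forall>n\<ge>N. norm (\<phi> (u n) - \<phi> l) < e" by blast
  qed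
qed

lemma inner_tendsto_of_coords:
  fixes u :: "nat \<Rightarrow> 'i ell2"
  assumes "\<And>n. norm (u n) \<le> M" "\<And>i. (\<lambda>n. coord (u n) i) \<longlonglongrightarrow> coord l i"
  shows "(\<lambda>n. inner (u n) z) \<longlonglongrightarrow> inner l z"
  using weakly_convergent_to_coordI[OF assms] bounded_linear_inner_left[of z]
  by (auto simp: weakly_convergent_to_def)

text \<open>The coordinates lie in a product of compact intervals. Countability of the index type
  makes the product first countable, hence sequentially compact; the bound on finite square sums
  survives in the limit.\<close>

lemma bounded_imp_coordwise_convergent_subseq:
  fixes u :: "nat \<Rightarrow> 'i::countable ell2"
  assumes bdd: "\<And>n. norm (u n) \<le> M"
  obtains l \<rho> where "strict_mono (\<rho> :: nat \<Rightarrow> nat)" "\<And>i. (\<lambda>n. coord (u (\<rho> n)) i) \<longlonglongrightarrow> coord l i"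
proof -
  let ?C = "PiE UNIV (\<lambda>_ :: 'i. {-M..M})"
  have "compactin (product_topology (\<lambda>_. euclidean) UNIV) ?C"
    by (auto simp: compactin_PiE)
  then have "seq_compact ?C"
    by (simp add: euclidean_product_topology compact_imp_seq_compact)
  moreover have "coord (u n) \<in> ?C" for n
    using order_trans[OF abs_coord_le_norm bdd, of n] by (auto simp: PiE_iff abs_le_iff minus_le_iff)
  ultimately obtain f \<rho> where f: "strict_mono (\<rho> :: nat \<Rightarrow> nat)" "((\<lambda>n. coord (u n)) \<circ> \<rho>) \<longlonglongrightarrow> f"
    unfolding seq_compact_def by metis
  have lim: "(\<lambda>n. coord (u (\<rho> n)) i) \<longlonglongrightarrow> f i" for i
    using continuous_on_tendsto_compose[OF continuous_on_product_coordinates[of i] f(2)] by simp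
  have "(\<Sum>i\<in>F. (f i)\<^sup>2) \<le> M\<^sup>2" if "finite F" for F
  proof (rule LIMSEQ_le_const2)
    show "(\<lambda>n. \<Sum>i\<in>F. (coord (u (\<rho> n)) i)\<^sup>2) \<longlonglongrightarrow> (\<Sum>i\<in>F. (f i)\<^sup>2)"
      by (intro tendsto_intros lim)
    show "\<exists>N. \<forall>n\<ge>N. (\<Sum>i\<in>F. (coord (u (\<rho> n)) i)\<^sup>2) \<le> M\<^sup>2"
      using order_trans[OF sum_coord_square_le[OF that] power_mono[OF bdd norm_ge_zero]] by blast
  qed
  then have "(\<lambda>i. (f i)\<^sup>2) summable_on UNIV"
    by (intro nonneg_bdd_above_summable_on bdd_aboveI2[where M = "M\<^sup>2"]) auto
  then have "coord (Abs_ell2 f) = f" by (simp add: Abs_ell2_inverse)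
  with f(1) lim show ?thesis by (intro that[of \<rho> "Abs_ell2 f"]) auto
qed

text \<open>Opial's argument: if \<open>l\<close> and \<open>m\<close> are two weak cluster points, then \<open>\<parallel>u n - l\<parallel>\<^sup>2 - \<parallel>u n - m\<parallel>\<^sup>2\<close>
  converges, hence so does \<open>u n \<bullet> (m - l)\<close>, whose limits along the two subsequences differ by
  \<open>\<parallel>m - l\<parallel>\<^sup>2\<close>.\<close>

lemma fejer_imp_coordwise_convergent:
  fixes u :: "nat \<Rightarrow> 'i::countable ell2"
  assumes bdd: "\<And>n. norm (u n) \<le> M"
    and cluster: "\<And>\<rho> l. strict_mono (\<rho> :: nat \<Rightarrow> nat) \<Longrightarrow>
          (\<And>i. (\<lambda>n. coord (u (\<rho> n)) i) \<longlonglongrightarrow> coord l i) \<Longrightarrow> l \<in> Z"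
    and fejer: "\<And>z n. z \<in> Z \<Longrightarrow> norm (u (Suc n) - z) \<le> norm (u n - z)"
  obtains l where "l \<in> Z" "\<And>i. (\<lambda>n. coord (u n) i) \<longlonglongrightarrow> coord l i"
proof -
  obtain l \<rho> where l: "strict_mono (\<rho> :: nat \<Rightarrow> nat)" "\<And>i. (\<lambda>n. coord (u (\<rho> n)) i) \<longlonglongrightarrow> coord l i"
    using bounded_imp_coordwise_convergent_subseq[of u, OF bdd] by blast
  have lZ: "l \<in> Z" by (rule cluster[OF l])
  have conv: "convergent (\<lambda>n. (norm (u n - z))\<^sup>2)" if "z \<in> Z" for z
  proof -
    have "decseq (\<lambda>n. norm (u n - z))" using fejer[OF that] by (rule decseq_SucI)
    then obtain d where "(\<lambda>n. norm (u n - z)) \<longlonglongrightarrow> d"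
      using decseq_convergent[of _ 0] by (metis norm_ge_zero)
    then show ?thesis by (auto intro: convergentI tendsto_power)
  qed
  have unique: "m = l"
    if m: "strict_mono (\<sigma> :: nat \<Rightarrow> nat)" "\<And>i. (\<lambda>n. coord (u (\<sigma> n)) i) \<longlonglongrightarrow> coord m i" for \<sigma> m
  proof -
    have "convergent (\<lambda>n. (norm (u n - l))\<^sup>2 - (norm (u n - m))\<^sup>2)"
      by (intro convergent_diff conv lZ cluster[OF m])
    then obtain d where "(\<lambda>n. (norm (u n - l))\<^sup>2 - (norm (u n - m))\<^sup>2) \<longlonglongrightarrow> d"
      by (auto simp: convergent_def)
    then have "(\<lambda>n. ((norm (u n - l))\<^sup>2 - (norm (u n - m))\<^sup>2 + (norm m)\<^sup>2 - (norm l)\<^sup>2) / 2)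
        \<longlonglongrightarrow> (d + (norm m)\<^sup>2 - (norm l)\<^sup>2) / 2"
      by (intro tendsto_intros) auto
    moreover have "((norm (u n - l))\<^sup>2 - (norm (u n - m))\<^sup>2 + (norm m)\<^sup>2 - (norm l)\<^sup>2) / 2
        = inner (u n) (m - l)" for n
      by (simp add: power2_norm_eq_inner inner_diff_left inner_diff_right inner_commute)
    ultimately obtain e where e: "(\<lambda>n. inner (u n) (m - l)) \<longlonglongrightarrow> e" by auto
    have 1: "e = inner l (m - l)"
      by (rule LIMSEQ_unique[OF LIMSEQ_subseq_LIMSEQ[OF e l(1), unfolded o_def]
            inner_tendsto_of_coords[OF bdd l(2)]])
    have "e = inner m (m - l)"
      by (rule LIMSEQ_unique[OF LIMSEQ_subseq_LIMSEQ[OF e m(1), unfolded o_def]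
            inner_tendsto_of_coords[OF bdd m(2)]])
    with 1 have "inner (m - l) (m - l) = 0" by (simp add: inner_diff_left)
    then show ?thesis by simp
  qed
  have "(\<lambda>n. coord (u n) i) \<longlonglongrightarrow> coord l i" for i
  proof (rule ccontr)
    assume "\<not> ?thesis"
    then obtain e where e: "e > 0" "\<And>N. \<exists>n\<ge>N. e \<le> dist (coord (u n) i) (coord l i)"
      unfolding lim_sequentially by (auto simp: not_less)
    then have "infinite {n. e \<le> dist (coord (u n) i) (coord l i)}"
      by (auto simp: infinite_nat_iff_unbounded_le)
    then obtain \<tau> :: "nat \<Rightarrow> nat"
      where \<tau>: "strict_mono \<tau>" "\<And>n. e \<le> dist (coord (u (\<tau> n)) i) (coord l i)"
      using infinite_enumerate by blast
    obtain m \<sigma> where m: "strict_mono (\<sigma> :: nat \<Rightarrow> nat)"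
        "\<And>j. (\<lambda>n. coord (u (\<tau> (\<sigma> n))) j) \<longlonglongrightarrow> coord m j"
      using bounded_imp_coordwise_convergent_subseq[of "\<lambda>n. u (\<tau> n)", OF bdd] by blast
    have "m = l"
      by (rule unique[of "\<tau> \<circ> \<sigma>"]) (use \<tau>(1) m in \<open>auto simp: strict_mono_o\<close>)
    then have "\<exists>n. dist (coord (u (\<tau> (\<sigma> n))) i) (coord l i) < e"
      using m(2)[of i] e(1) unfolding lim_sequentially by blast
    with \<tau>(2) show False by (meson not_less)
  qed
  with lZ show ?thesis by (rule that)
qed

section \<open>Adjoints and the Landweber step\<close>

lemma coord_adjoint:
  fixes T :: "'i ell2 \<Rightarrow> 'k ell2"
  shows "bounded_linear T \<Longrightarrow> coord (adjoint T y) i = inner y (T (unit_ell2 i))"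
  using adjoint_ell2[of T "unit_ell2 i" y] inner_unit_ell2[of "adjoint T y" i]
  by (simp add: inner_commute del: inner_unit_ell2)

lemma adjoint_diff_ell2:
  fixes T :: "'i ell2 \<Rightarrow> 'k ell2"
  shows "bounded_linear T \<Longrightarrow> adjoint T (x - y) = adjoint T x - adjoint T y"
  by (rule ell2_eqI) (simp add: coord_adjoint inner_diff_left)

lemma norm_adjoint_le:
  fixes T :: "'i ell2 \<Rightarrow> 'k ell2"
  assumes T: "bounded_linear T" "onorm T \<le> 1"
  shows "norm (adjoint T y) \<le> norm y"
proof (cases "adjoint T y = 0")
  case False
  have contr: "norm (T x) \<le> norm x" for x
    using onorm[OF T(1), of x] mult_right_mono[OF T(2) norm_ge_zero[of x]] by simp
  have "norm (adjoint T y) * norm (adjoint T y) = inner (T (adjoint T y)) y"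
    by (simp add: adjoint_ell2[OF T(1)] power2_norm_eq_inner flip: power2_eq_square)
  also have "\<dots> \<le> norm (T (adjoint T y)) * norm y" by (rule norm_cauchy_schwarz)
  also have "\<dots> \<le> norm (adjoint T y) * norm y" by (intro mult_right_mono contr) simp
  finally show ?thesis using False by simp
qed simp

text \<open>The expanded square contains \<open>- 2 * (norm (T x))\<^sup>2\<close>, and
  \<open>(norm (adjoint T (T x)))\<^sup>2\<close> is at most half of what this removes.\<close>

lemma norm_landweber_le:
  fixes T :: "'i ell2 \<Rightarrow> 'k ell2"
  assumes T: "bounded_linear T" "onorm T \<le> 1"
  shows "norm (x - adjoint T (T x)) \<le> norm x"
proof -
  have "(norm (x - adjoint T (T x)))\<^sup>2 = (norm x)\<^sup>2 - 2 * (norm (T x))\<^sup>2 + (norm (adjoint T (T x)))\<^sup>2"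
    using adjoint_ell2[OF T(1), of x "T x"]
    by (simp add: power2_norm_eq_inner inner_diff_left inner_diff_right inner_commute)
  moreover have "(norm (adjoint T (T x)))\<^sup>2 \<le> (norm (T x))\<^sup>2"
    by (intro power_mono norm_adjoint_le[OF T]) simp
  ultimately have "(norm (x - adjoint T (T x)))\<^sup>2 \<le> (norm x)\<^sup>2"
    using zero_le_power2[of "norm (T x)"] by linarith
  then show ?thesis by simp
qed

section \<open>Least squares on finitely many coordinates\<close>

lemma supported_eq_sum:
  assumes "finite F" "\<And>i. i \<notin> F \<Longrightarrow> coord v i = 0"
  shows "v = (\<Sum>j\<in>F. coord v j *\<^sub>R unit_ell2 j)"
  by (rule ell2_eqI) (use assms in \<open>auto simp: coord_finite_combination simp del: coord_sum\<close>)

lemma orthogonal_image_supported: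
  assumes "linear T" "finite F" "\<And>i. i \<notin> F \<Longrightarrow> coord v i = 0"
    and "\<And>j. j \<in> F \<Longrightarrow> inner q (T (unit_ell2 j)) = 0"
  shows "inner q (T v) = 0"
proof -
  interpret linear T by fact
  have "T v = (\<Sum>j\<in>F. coord v j *\<^sub>R T (unit_ell2 j))"
    by (subst supported_eq_sum[OF assms(2,3)]) (simp_all add: sum scale)
  then show ?thesis using assms(4) by (simp add: inner_sum_right)
qed

text \<open>Gram-Schmidt on the columns \<open>T (unit_ell2 j)\<close>: it solves the normal
  equations with a bound \<open>c\<close> uniform in the data, a bounded pseudo-inverse on the
  coordinates in \<open>F\<close>.\<close>

lemma least_squares_finite_support:
  fixes T :: "'i ell2 \<Rightarrow> 'k ell2"
  assumes T: "linear T" and "finite F"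
  shows "\<exists>c\<ge>0. \<forall>y. \<exists>v. (\<forall>i. i \<notin> F \<longrightarrow> coord v i = 0) \<and> norm v \<le> c * norm y
      \<and> (\<forall>j\<in>F. inner (y - T v) (T (unit_ell2 j)) = 0)"
  using assms(2)
proof induction
  case empty
  have "\<exists>v :: 'i ell2. (\<forall>i. i \<notin> {} \<longrightarrow> coord v i = 0) \<and> norm v \<le> 0 * norm y
      \<and> (\<forall>j\<in>{}. inner (y - T v) (T (unit_ell2 j)) = 0)" for y
    by (intro exI[of _ 0]) simp
  then show ?case by (intro exI[of _ "0 :: real"] conjI allI order_refl)
next
  case (insert i F)
  interpret linear T by fact
  obtain c where c: "c \<ge> 0" "\<forall>y. \<exists>v. (\<forall>i. i \<notin> F \<longrightarrow> coord v i = 0) \<and> norm v \<le> c * norm y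
      \<and> (\<forall>j\<in>F. inner (y - T v) (T (unit_ell2 j)) = 0)"
    using insert.IH by blast
  from choice[OF c(2)] obtain V where
      V: "\<And>y i. i \<notin> F \<Longrightarrow> coord (V y) i = 0" "\<And>y. norm (V y) \<le> c * norm y"
    and Vo: "\<And>y j. j \<in> F \<Longrightarrow> inner (y - T (V y)) (T (unit_ell2 j)) = 0"
    by blast
  \<comment> \<open>\<open>v0\<close> fits the new column by the old ones; the residual
    \<open>q\<close> is orthogonal to them, and \<open>q = 0\<close> means that the old solution
    already suffices.\<close>
  define v0 where "v0 = V (T (unit_ell2 i))"
  define q where "q = T (unit_ell2 i) - T v0"
  have q: "inner q (T v) = 0" if "\<And>i. i \<notin> F \<Longrightarrow> coord v i = 0" for v
    unfolding q_def v0_def by (rule orthogonal_image_supported[OF T insert.hyps(1) that Vo])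
  have Ti: "T (unit_ell2 i) = q + T v0" by (simp add: q_def)
  have Vo': "inner (y - T (V y)) (T v0) = 0" for y
    unfolding v0_def by (rule orthogonal_image_supported[OF T insert.hyps(1) V(1) Vo])
  show ?case
  proof (cases "q = 0")
    case True
    have "inner (y - T (V y)) (T (unit_ell2 i)) = 0" for y
      unfolding Ti True add_0_left by (rule Vo')
    with V Vo have "\<exists>v. (\<forall>j. j \<notin> insert i F \<longrightarrow> coord v j = 0) \<and> norm v \<le> c * norm y
        \<and> (\<forall>j\<in>insert i F. inner (y - T v) (T (unit_ell2 j)) = 0)" for y
      by (intro exI[of _ "V y"]) blast
    with c(1) show ?thesis by blast
  next
    case False
    define \<kappa> where "\<kappa> y = inner y q / inner q q" for y
    \<comment> \<open>\<open>T\<close> maps \<open>unit_ell2 i - v0\<close> to \<open>q\<close>, so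
      this removes the component of \<open>y\<close> along \<open>q\<close> without disturbing the
      old orthogonality.\<close>
    define W where "W y = V y + \<kappa> y *\<^sub>R (unit_ell2 i - v0)" for y
    have res: "y - T (W y) = y - T (V y) - \<kappa> y *\<^sub>R q" for y
      by (simp add: W_def add scale diff q_def)
    have "coord (W y) j = 0" if "j \<notin> insert i F" for y j
      using that V(1) by (simp add: W_def v0_def)
    moreover have "norm (W y) \<le> (c + norm (unit_ell2 i - v0) / norm q) * norm y" for y
    proof -
      have "\<bar>\<kappa> y\<bar> \<le> norm y / norm q"
        using Cauchy_Schwarz_ineq2[of y q] False
        by (simp add: \<kappa>_def power2_norm_eq_inner[symmetric] power2_eq_square field_simps)
      then have "norm (\<kappa> y *\<^sub>R (unit_ell2 i - v0)) \<le> norm y / norm q * norm (unit_ell2 i - v0)"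
        unfolding norm_scaleR by (intro mult_right_mono) auto
      then show ?thesis using V(2)[of y] norm_triangle_ineq[of "V y" "\<kappa> y *\<^sub>R (unit_ell2 i - v0)"]
        by (simp add: W_def algebra_simps)
    qed
    moreover have "inner (y - T (W y)) (T (unit_ell2 j)) = 0" if "j \<in> insert i F" for y j
    proof (cases "j = i")
      case True
      note Vo'[of y]
      moreover have "inner q (T v0) = 0" "inner (T (V y)) q = 0"
        using q V(1) by (auto simp: v0_def inner_commute[of _ q])
      moreover have "\<kappa> y * inner q q = inner y q" using False by (simp add: \<kappa>_def)
      ultimately show ?thesis
        unfolding True res Ti by (simp add: inner_diff_left inner_add_right)
    next
      case False
      then have j: "j \<in> F" using that by simp
      have "inner q (T (unit_ell2 j)) = 0" using j by (intro q) auto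
      then show ?thesis using Vo[OF j, of y] by (simp only: res inner_diff_left inner_scaleR_left)
    qed
    ultimately have "\<exists>v. (\<forall>j. j \<notin> insert i F \<longrightarrow> coord v j = 0)
        \<and> norm v \<le> (c + norm (unit_ell2 i - v0) / norm q) * norm y
        \<and> (\<forall>j\<in>insert i F. inner (y - T v) (T (unit_ell2 j)) = 0)" for y
      by (intro exI[of _ "W y"]) blast
    moreover have "0 \<le> c + norm (unit_ell2 i - v0) / norm q" using c(1) by simp
    ultimately show ?thesis by blast
  qed
qed

text \<open>Take the least squares solution \<open>v\<close> for the data \<open>T w\<close>. Its
  residual lies in the span it is orthogonal to, so \<open>w - v\<close> is in the kernel, hence
  orthogonal to \<open>w\<close>, and the bound on \<open>v\<close> passes to
  \<open>w\<close>.\<close>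

lemma norm_le_of_orthogonal_to_kernel:
  fixes T :: "'i ell2 \<Rightarrow> 'k ell2"
  assumes T: "linear T" and F: "finite F"
  shows "\<exists>c\<ge>0. \<forall>w. (\<forall>i. i \<notin> F \<longrightarrow> coord w i = 0) \<longrightarrow>
      (\<forall>v. (\<forall>i. i \<notin> F \<longrightarrow> coord v i = 0) \<longrightarrow> T v = 0 \<longrightarrow> inner w v = 0) \<longrightarrow> norm w \<le> c * norm (T w)"
proof -
  interpret linear T by fact
  obtain c where c: "c \<ge> 0" "\<And>y. \<exists>v. (\<forall>i. i \<notin> F \<longrightarrow> coord v i = 0) \<and> norm v \<le> c * norm y
      \<and> (\<forall>j\<in>F. inner (y - T v) (T (unit_ell2 j)) = 0)"
    using least_squares_finite_support[OF assms] by blast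
  have "norm w \<le> c * norm (T w)"
    if w: "\<And>i. i \<notin> F \<Longrightarrow> coord w i = 0"
      "\<And>v. (\<And>i. i \<notin> F \<Longrightarrow> coord v i = 0) \<Longrightarrow> T v = 0 \<Longrightarrow> inner w v = 0" for w
  proof (cases "w = 0")
    case False
    obtain v where v: "\<And>i. i \<notin> F \<Longrightarrow> coord v i = 0" "norm v \<le> c * norm (T w)"
        "\<And>j. j \<in> F \<Longrightarrow> inner (T w - T v) (T (unit_ell2 j)) = 0"
      using c(2)[of "T w"] by blast
    have wv: "coord (w - v) i = 0" if "i \<notin> F" for i
      using that v(1) w(1) by simp
    have "inner (T w - T v) (T (w - v)) = 0"
      by (rule orthogonal_image_supported[OF T F wv v(3)])
    then have "T (w - v) = 0" by (simp add: diff)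
    from w(2)[OF wv this] have "inner w (w - v) = 0" .
    then have "norm w * norm w = inner w v"
      by (simp add: inner_diff_right power2_norm_eq_inner flip: power2_eq_square)
    also have "\<dots> \<le> norm w * norm v" by (rule norm_cauchy_schwarz)
    finally have "norm w \<le> norm v" using False by simp
    with v(2) show ?thesis by simp
  qed (use c in simp)
  with c(1) show ?thesis by (intro exI[of _ c]) simp
qed

section \<open>The iteration\<close>

lemma summable_on_of_ennreal_infsum_finite:
  fixes f :: "'i \<Rightarrow> real"
  assumes "\<And>i. 0 \<le> f i" and fin: "(\<Sum>\<^sub>\<infinity>i. ennreal (f i)) < \<infinity>"
  shows "f summable_on UNIV"
proof (rule nonneg_bdd_above_summable_on)
  show "bdd_above (sum f ` {F. F \<subseteq> UNIV \<and> finite F})"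
  proof (rule bdd_aboveI2[where M = "enn2real (\<Sum>\<^sub>\<infinity>i. ennreal (f i))"])
    fix F :: "'i set" assume "F \<in> {F. F \<subseteq> UNIV \<and> finite F}"
    then have "(\<Sum>i\<in>F. ennreal (f i)) \<le> (\<Sum>\<^sub>\<infinity>i. ennreal (f i))"
      by (subst nonneg_infsum_complete) (auto intro: SUP_upper)
    then have "ennreal (sum f F) \<le> (\<Sum>\<^sub>\<infinity>i. ennreal (f i))"
      using assms(1) by simp
    then have "enn2real (ennreal (sum f F)) \<le> enn2real (\<Sum>\<^sub>\<infinity>i. ennreal (f i))"
      using fin by (intro enn2real_mono) auto
    then show "sum f F \<le> enn2real (\<Sum>\<^sub>\<infinity>i. ennreal (f i))"
      using assms(1) by (simp add: sum_nonneg)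
  qed
qed (use assms in auto)

lemma norm_le_of_abs_coord_le:
  assumes "\<And>i. \<bar>coord x i\<bar> \<le> \<bar>coord y i\<bar>"
  shows "norm x \<le> norm y"
proof -
  have "(norm x)\<^sup>2 \<le> (norm y)\<^sup>2"
    unfolding norm_ell2_square using assms
    by (intro infsum_mono summable_coord_square) (simp add: abs_le_square_iff)
  then show ?thesis by simp
qed

lemma inner_eq_0_of_disjoint:
  assumes "\<And>i. coord x i = 0 \<or> coord y i = 0"
  shows "inner x y = 0"
proof -
  have "coord x i * coord y i = 0" for i using assms[of i] by auto
  then show ?thesis by (simp only: inner_ell2_def infsum_0)
qed

text \<open>Being a linear combination, it needs no new summability proof; for infinite
  \<open>F\<close> the sum defaults to 0.\<close>

definition restrict_coords :: "'i set \<Rightarrow> 'i ell2 \<Rightarrow> 'i ell2" where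
  "restrict_coords F x = (\<Sum>j\<in>F. coord x j *\<^sub>R unit_ell2 j)"

lemma coord_restrict_coords: "finite F \<Longrightarrow> coord (restrict_coords F x) i = (if i \<in> F then coord x i else 0)"
  unfolding restrict_coords_def by (rule coord_finite_combination)

locale thresholded_landweber = jump_threshold p r l h for p r l h +
  fixes T :: "'i::countable ell2 \<Rightarrow> 'k::countable ell2" and g :: "'k ell2"
  assumes H_cut: "H p r = cut"
    and T_blin: "bounded_linear T" and T_lt_1: "onorm T < 1"
begin

sublocale bounded_linear T by (rule T_blin)

abbreviation pen :: "real \<Rightarrow> real" where
  "pen t \<equiv> min (\<bar>t\<bar> powr p) (r powr p)"

lemma pen_nonneg: "0 \<le> pen t" by simp

text \<open>Real-valued counterpart of \<open>J\<close>. A divergent \<open>infsum\<close> is 0, so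
  summability of the penalty is carried along separately.\<close>

definition energy :: "'i ell2 \<Rightarrow> real" where
  "energy u = (norm (T u - g))\<^sup>2 + (\<Sum>\<^sub>\<infinity>i. pen (coord u i))"

definition grad_step :: "'i ell2 \<Rightarrow> 'i ell2" where
  "grad_step u = u - adjoint T (T u) + adjoint T g"

lemma coord_HH_cut: "coord (HH T g p r u) i = cut (coord (grad_step u) i)"
  using coord_HH[OF p1, of T g r u i] by (simp only: H_cut grad_step_def)

lemma grad_step_eq: "grad_step u = u + adjoint T (g - T u)"
  by (simp add: grad_step_def adjoint_diff_ell2[OF T_blin])

lemma norm_grad_step_diff_le: "norm (grad_step u - grad_step v) \<le> norm (u - v)"
proof -
  have "grad_step u - grad_step v = (u - v) - adjoint T (T (u - v))"
    by (simp add: grad_step_def diff adjoint_diff_ell2[OF T_blin])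
  then show ?thesis using norm_landweber_le[OF T_blin, of "u - v"] T_lt_1 by simp
qed

lemma energy_nonneg: "0 \<le> energy u"
  unfolding energy_def by (intro add_nonneg_nonneg infsum_nonneg) auto

text \<open>The surrogate functional \<open>w \<mapsto> J w + \<parallel>w - a\<parallel>\<^sup>2 - \<parallel>T (w - a)\<parallel>\<^sup>2\<close> decouples into scalar problems
  with data \<open>grad_step a\<close>, and thresholding solves each of them.\<close>

lemma energy_descent:
  assumes sum: "(\<lambda>i. pen (coord a i)) summable_on UNIV"
  defines "u \<equiv> HH T g p r a"
  shows "(\<lambda>i. pen (coord u i)) summable_on UNIV"
    and "energy u + (1 - (onorm T)\<^sup>2) * (norm (u - a))\<^sup>2 \<le> energy a"
proof -
  define v where "v = grad_step a"
  have pt: "(coord (u - v) i)\<^sup>2 + pen (coord u i) \<le> (coord (a - v) i)\<^sup>2 + pen (coord a i)" for i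
    using cut_minimizes[of "coord v i" "coord a i"] by (simp add: u_def v_def coord_HH_cut)
  have sa: "(\<lambda>i. (coord (a - v) i)\<^sup>2 + pen (coord a i)) summable_on UNIV"
    by (intro summable_on_add summable_coord_square sum)
  have "pen (coord u i) \<le> (coord (a - v) i)\<^sup>2 + pen (coord a i)" for i
    using pt[of i] zero_le_power2[of "coord (u - v) i"] by linarith
  then show su: "(\<lambda>i. pen (coord u i)) summable_on UNIV"
    by (intro summable_on_comparison_test[OF sa] pen_nonneg)
  have "(\<Sum>\<^sub>\<infinity>i. (coord (u - v) i)\<^sup>2 + pen (coord u i)) \<le> (\<Sum>\<^sub>\<infinity>i. (coord (a - v) i)\<^sup>2 + pen (coord a i))"
    by (intro infsum_mono summable_on_add summable_coord_square sum su pt)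
  then have "(norm (u - v))\<^sup>2 + (\<Sum>\<^sub>\<infinity>i. pen (coord u i)) \<le> (norm (a - v))\<^sup>2 + (\<Sum>\<^sub>\<infinity>i. pen (coord a i))"
    by (simp only: infsum_add summable_coord_square sum su norm_ell2_square)
  moreover have "(norm (u - v))\<^sup>2 = (norm (a - v))\<^sup>2 + 2 * inner (u - a) (a - v) + (norm (u - a))\<^sup>2"
    by (simp add: power2_norm_eq_inner inner_diff_left inner_diff_right inner_commute algebra_simps)
  moreover have "inner (u - a) (a - v) = inner (T (u - a)) (T a - g)"
    unfolding v_def grad_step_def
    by (simp add: adjoint_ell2[OF T_blin] adjoint_diff_ell2[OF T_blin])
  moreover have "2 * inner (T (u - a)) (T a - g)
      = (norm (T u - g))\<^sup>2 - (norm (T a - g))\<^sup>2 - (norm (T (u - a)))\<^sup>2"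
    by (simp add: diff power2_norm_eq_inner inner_diff_left inner_diff_right inner_commute algebra_simps)
  \<comment> \<open>The comparison leaves
    \<open>(norm (u - a))\<^sup>2 - (norm (T (u - a)))\<^sup>2\<close> as gain; bounding the second
    term produces the factor \<open>1 - (onorm T)\<^sup>2\<close>.\<close>
  moreover have "(norm (T (u - a)))\<^sup>2 \<le> (onorm T)\<^sup>2 * (norm (u - a))\<^sup>2"
    unfolding power_mult_distrib[symmetric] by (intro power_mono onorm[OF T_blin]) simp
  ultimately show "energy u + (1 - (onorm T)\<^sup>2) * (norm (u - a))\<^sup>2 \<le> energy a"
    unfolding energy_def left_diff_distrib by linarith
qed

text \<open>A coordinate of \<open>adjoint T (T z)\<close> is the inner product of \<open>z\<close>
  with a fixed vector, so weak information suffices.\<close>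

lemma coord_grad_step_tendsto:
  assumes "\<And>n. norm (x n) \<le> M" "\<And>i. (\<lambda>n. coord (x n) i) \<longlonglongrightarrow> coord y i"
  shows "(\<lambda>n. coord (grad_step (x n)) i) \<longlonglongrightarrow> coord (grad_step y) i"
proof -
  have "coord (grad_step z) i = coord z i - inner z (adjoint T (T (unit_ell2 i))) + coord (adjoint T g) i" for z
    by (simp add: grad_step_def coord_adjoint[OF T_blin, of "T z"] flip: adjoint_ell2[OF T_blin])
  then show ?thesis
    by (simp only:) (intro tendsto_intros inner_tendsto_of_coords[OF assms] assms)
qed

end

section \<open>Energy decrease and vanishing steps\<close>

locale thresholded_landweber_sequence = thresholded_landweber p r l h T g
  for p r l h and T :: "'i::countable ell2 \<Rightarrow> 'k::countable ell2" and g +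
  fixes u0 :: "'i ell2"
  assumes u0: "(\<lambda>i. pen (coord u0 i)) summable_on UNIV"
    and p2: "p \<le> 2 \<or> finite (UNIV :: 'i set)"
begin

definition U :: "nat \<Rightarrow> 'i ell2" where
  "U n = (HH T g p r ^^ n) u0"

lemma U_Suc: "U (Suc n) = HH T g p r (U n)"
  by (simp add: U_def)

lemma summable_U: "(\<lambda>i. pen (coord (U n) i)) summable_on UNIV"
proof (induction n)
  case 0
  show ?case using u0 by (simp add: U_def)
next
  case (Suc n)
  show ?case unfolding U_Suc by (rule energy_descent(1)[OF Suc])
qed

lemma descent_gap: "0 < 1 - (onorm T)\<^sup>2"
  using T_lt_1 onorm_pos_le[OF T_blin] by (simp add: power_strict_mono[of "onorm T" 1 2, simplified])

lemma energy_U: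
  "energy (U (Suc n)) + (1 - (onorm T)\<^sup>2) * (norm (U (Suc n) - U n))\<^sup>2 \<le> energy (U n)"
  unfolding U_Suc by (rule energy_descent(2)[OF summable_U])

lemma decseq_energy: "decseq (\<lambda>n. energy (U n))"
proof (rule decseq_SucI)
  fix n
  have "0 \<le> (1 - (onorm T)\<^sup>2) * (norm (U (Suc n) - U n))\<^sup>2" using descent_gap by simp
  then show "energy (U (Suc n)) \<le> energy (U n)" using energy_U[of n] by linarith
qed

lemma energy_U_le: "energy (U n) \<le> energy u0"
  using decseqD[OF decseq_energy, of 0 n] by (simp add: U_def)

lemma steps_tendsto_0: "(\<lambda>n. norm (U (Suc n) - U n)) \<longlonglongrightarrow> 0"
proof -
  obtain E where E: "(\<lambda>n. energy (U n)) \<longlonglongrightarrow> E"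
    using decseq_convergent[OF decseq_energy, of 0] energy_nonneg by metis
  have "(\<lambda>n. (energy (U n) - energy (U (Suc n))) / (1 - (onorm T)\<^sup>2)) \<longlonglongrightarrow> (E - E) / (1 - (onorm T)\<^sup>2)"
    using descent_gap by (intro tendsto_intros E LIMSEQ_Suc) auto
  then have lim: "(\<lambda>n. (energy (U n) - energy (U (Suc n))) / (1 - (onorm T)\<^sup>2)) \<longlonglongrightarrow> 0" by simp
  have "(norm (U (Suc n) - U n))\<^sup>2 \<le> (energy (U n) - energy (U (Suc n))) / (1 - (onorm T)\<^sup>2)" for n
    using energy_U[of n] descent_gap by (simp add: pos_le_divide_eq mult.commute)
  then have "(\<lambda>n. (norm (U (Suc n) - U n))\<^sup>2) \<longlonglongrightarrow> 0"
    by (intro tendsto_sandwich[OF _ _ tendsto_const lim]) auto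
  then have "(\<lambda>n. sqrt ((norm (U (Suc n) - U n))\<^sup>2)) \<longlonglongrightarrow> sqrt 0" by (rule tendsto_real_sqrt)
  then show ?thesis by simp
qed

lemma U_Suc_dichotomy: "l < \<bar>coord (U (Suc n)) i\<bar> \<or> \<bar>coord (U (Suc n)) i\<bar> \<le> h l"
  unfolding U_Suc coord_HH_cut using abs_cut_gt_iff abs_cut_le by (meson not_less)

text \<open>Crossing the threshold costs a step of length at least the jump, which is impossible once
  the steps are short.\<close>

lemma support_freezes:
  "\<exists>N I. finite I \<and> (\<forall>n\<ge>N. \<forall>i. if i \<in> I then l < \<bar>coord (U n) i\<bar> else \<bar>coord (U n) i\<bar> \<le> h l)"
proof -
  have hl: "h l < l" using h_l_le_r r_less_l by simp
  then obtain N0 where N0: "\<And>n. n \<ge> N0 \<Longrightarrow> norm (U (Suc n) - U n) < l - h l"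
    using LIMSEQ_D[OF steps_tendsto_0, of "l - h l"] by auto
  \<comment> \<open>The dichotomy holds only for iterates produced by thresholding, so the start
    must be a successor.\<close>
  define N where "N = Suc N0"
  define I where "I = {i. l < \<bar>coord (U N) i\<bar>}"
  have "\<forall>i. if i \<in> I then l < \<bar>coord (U n) i\<bar> else \<bar>coord (U n) i\<bar> \<le> h l" if "n \<ge> N" for n
    using that
  proof (induction n rule: dec_induct)
    case base
    show ?case using U_Suc_dichotomy[of N0] by (auto simp: I_def N_def)
  next
    case (step n)
    show ?case
    proof
      fix i
      have "\<bar>coord (U (Suc n)) i - coord (U n) i\<bar> < l - h l"
        using abs_coord_le_norm[of "U (Suc n) - U n" i] N0[of n] step.hyps by (simp add: N_def)
      then show "if i \<in> I then l < \<bar>coord (U (Suc n)) i\<bar> else \<bar>coord (U (Suc n)) i\<bar> \<le> h l"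
        using U_Suc_dichotomy[of n i] spec[OF step.IH, of i] hl by (auto split: if_splits)
    qed
  qed
  moreover have "finite I" unfolding I_def by (rule finite_large_coords[OF l0])
  ultimately show ?thesis by blast
qed

end

section \<open>The tail with a fixed set of large coordinates\<close>

locale frozen_sequence = thresholded_landweber_sequence p r l h T g u0
  for p r l h and T :: "'i::countable ell2 \<Rightarrow> 'k::countable ell2" and g u0 +
  fixes N :: nat and I :: "'i set"
  assumes fin_I: "finite I"
    and frozen: "\<And>n i. n \<ge> N \<Longrightarrow> if i \<in> I then l < \<bar>coord (U n) i\<bar> else \<bar>coord (U n) i\<bar> \<le> h l"
begin

text \<open>Replaces the discontinuous \<open>cut\<close> on the tail: the choice depends on the
  index instead of the value, which makes the map nonexpansive.\<close>

definition branch :: "'i \<Rightarrow> real \<Rightarrow> real" where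
  "branch i t = (if i \<in> I then t else h t)"

lemma branch_lipschitz: "\<bar>branch i x - branch i y\<bar> \<le> \<bar>x - y\<bar>"
  using h_lipschitz by (simp add: branch_def)

lemma coord_U_Suc:
  assumes "n \<ge> N"
  shows "coord (U (Suc n)) i = branch i (coord (grad_step (U n)) i)"
proof -
  have "l < \<bar>coord (grad_step (U n)) i\<bar> \<longleftrightarrow> i \<in> I"
    using frozen[of "Suc n" i] assms h_l_le_r r_less_l abs_cut_gt_iff[of "coord (grad_step (U n)) i"]
    unfolding U_Suc coord_HH_cut by (auto split: if_splits)
  then show ?thesis unfolding U_Suc coord_HH_cut by (auto simp: cut_def branch_def)
qed

text \<open>Outside \<open>I\<close> all coordinates are at most \<open>r\<close>. For
  \<open>p \<le> 2\<close> their squares are at most \<open>r powr (2 - p)\<close> times the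
  penalty, whose sum the energy bounds; otherwise there are only finitely many.\<close>

lemma tail_bounded: "\<exists>B. \<forall>n\<ge>N. norm (U n - restrict_coords I (U n)) \<le> B"
proof -
  let ?x = "\<lambda>n. U n - restrict_coords I (U n)"
  have c: "coord (?x n) i = (if i \<in> I then 0 else coord (U n) i)" for n i
    using fin_I by (simp add: coord_restrict_coords)
  have le_r: "\<bar>coord (?x n) i\<bar> \<le> r" if "n \<ge> N" for n i
    using frozen[OF that, of i] h_l_le_r r0 unfolding c by (simp split: if_splits)
  have "\<exists>B. \<forall>n\<ge>N. (norm (?x n))\<^sup>2 \<le> B"
    using p2
  proof
    assume p2: "p \<le> 2"
    have "(norm (?x n))\<^sup>2 \<le> r powr (2 - p) * energy u0" if n: "n \<ge> N" for n
    proof -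
      have pt: "(coord (?x n) i)\<^sup>2 \<le> r powr (2 - p) * pen (coord (U n) i)" for i
      proof (cases "coord (?x n) i = 0")
        case True
        then show ?thesis using r0 by simp
      next
        case False
        define t where "t = \<bar>coord (U n) i\<bar>"
        have t: "0 < t" "t \<le> r" "coord (?x n) i = coord (U n) i"
          using False le_r[OF n, of i] unfolding c t_def by (auto split: if_splits)
        have "t powr p \<le> r powr p" using t p1 by (intro powr_mono2) auto
        then have "pen (coord (U n) i) = t powr p" by (simp add: t_def)
        moreover have "t powr (2 - p) * t powr p \<le> r powr (2 - p) * t powr p"
          using t p2 by (intro mult_right_mono powr_mono2) auto
        moreover have "t powr (2 - p) * t powr p = t\<^sup>2"
          using t by (simp flip: powr_add)
        ultimately show ?thesis using t(3) by (simp add: t_def)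
      qed
      have "(norm (?x n))\<^sup>2 \<le> (\<Sum>\<^sub>\<infinity>i. r powr (2 - p) * pen (coord (U n) i))"
        unfolding norm_ell2_square
        by (intro infsum_mono summable_coord_square summable_on_cmult_right summable_U pt)
      also have "\<dots> = r powr (2 - p) * (\<Sum>\<^sub>\<infinity>i. pen (coord (U n) i))"
        by (rule infsum_cmult_right')
      also have "\<dots> \<le> r powr (2 - p) * energy u0"
      proof (intro mult_left_mono)
        have "(\<Sum>\<^sub>\<infinity>i. pen (coord (U n) i)) \<le> energy (U n)" by (simp add: energy_def)
        then show "(\<Sum>\<^sub>\<infinity>i. pen (coord (U n) i)) \<le> energy u0" using energy_U_le[of n] by linarith
      qed simp
      finally show ?thesis .
    qed
    then show ?thesis by blast
  next
    assume fin: "finite (UNIV :: 'i set)"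
    have "(norm (?x n))\<^sup>2 \<le> (\<Sum>i\<in>(UNIV :: 'i set). r\<^sup>2)" if "n \<ge> N" for n
      unfolding norm_ell2_square using fin le_r[OF that] r0
      by (simp only: infsum_finite) (intro sum_mono, simp flip: abs_le_square_iff)
    then show ?thesis by blast
  qed
  then obtain B where B: "\<And>n. n \<ge> N \<Longrightarrow> (norm (?x n))\<^sup>2 \<le> B" by blast
  then show ?thesis by (intro exI[of _ "sqrt B"]) (auto intro: real_le_rsqrt)
qed

text \<open>On the frozen index set the iteration adds vectors of the form \<open>T\<^sup>* y\<close>, so the component in the
  kernel of \<open>T\<close> never changes; the rest is controlled by \<open>T\<close>, hence by the energy.\<close>

lemma U_bounded: "\<exists>M. \<forall>n\<ge>N. norm (U n) \<le> M"
proof -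
  obtain B where B: "\<And>n. n \<ge> N \<Longrightarrow> norm (U n - restrict_coords I (U n)) \<le> B"
    using tail_bounded by blast
  obtain c where c: "c \<ge> 0" and c_bound: "\<And>w. (\<forall>i. i \<notin> I \<longrightarrow> coord w i = 0) \<Longrightarrow>
      (\<forall>v. (\<forall>i. i \<notin> I \<longrightarrow> coord v i = 0) \<longrightarrow> T v = 0 \<longrightarrow> inner w v = 0) \<Longrightarrow> norm w \<le> c * norm (T w)"
    using norm_le_of_orthogonal_to_kernel[OF linear_axioms fin_I] by blast
  have ker: "inner (U n) v = inner (U N) v"
    if v: "\<And>i. i \<notin> I \<Longrightarrow> coord v i = 0" "T v = 0" and "n \<ge> N" for n v
    using that(3)
  proof (induction n rule: dec_induct)
    case (step n)
    have "inner (U (Suc n) - grad_step (U n)) v = 0"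
      using v(1) coord_U_Suc[OF step.hyps(1)] by (intro inner_eq_0_of_disjoint) (auto simp: branch_def)
    moreover have "inner (grad_step (U n)) v = inner (U n) v"
      using adjoint_ell2[OF T_blin, of v "g - T (U n)"] v(2)
      by (simp add: grad_step_eq inner_add_left inner_add_right inner_commute[of _ v])
    ultimately show ?case using step.IH by (simp add: inner_diff_left)
  qed simp
  \<comment> \<open>The summands bound the three pieces of \<open>T w\<close> below: the residual at
    stage n, the image of the tail, and a term fixed at stage \<open>N\<close>.\<close>
  define K where "K = sqrt (energy u0) + B + norm (T (restrict_coords I (U N)) - g)"
  have "norm (U n) \<le> B + c * K + norm (restrict_coords I (U N))" if n: "n \<ge> N" for n
  proof -
    \<comment> \<open>A difference from stage \<open>N\<close> is taken because its component in the
      kernel vanishes.\<close>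
    define w where "w = restrict_coords I (U n) - restrict_coords I (U N)"
    have "norm w \<le> c * norm (T w)"
    proof (rule c_bound)
      show supp: "\<forall>i. i \<notin> I \<longrightarrow> coord w i = 0" using fin_I by (simp add: w_def coord_restrict_coords)
      show "\<forall>v. (\<forall>i. i \<notin> I \<longrightarrow> coord v i = 0) \<longrightarrow> T v = 0 \<longrightarrow> inner w v = 0"
      proof (intro allI impI)
        fix v assume v: "\<forall>i. i \<notin> I \<longrightarrow> coord v i = 0" "T v = 0"
        have "inner (w - (U n - U N)) v = 0"
          using v(1) fin_I by (intro inner_eq_0_of_disjoint) (auto simp: w_def coord_restrict_coords)
        then show "inner w v = 0" using ker[of v n] v n by (simp add: inner_diff_left)
      qed
    qed
    moreover have "norm (T w) \<le> K"
    proof -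
      have "(norm (T (U n) - g))\<^sup>2 \<le> energy (U n)"
        unfolding energy_def by (simp add: infsum_nonneg)
      then have 1: "norm (T (U n) - g) \<le> sqrt (energy u0)"
        using energy_U_le[of n] by (intro real_le_rsqrt) simp
      have "norm (T (U n - restrict_coords I (U n))) \<le> onorm T * norm (U n - restrict_coords I (U n))"
        by (rule onorm[OF T_blin])
      also have "\<dots> \<le> 1 * norm (U n - restrict_coords I (U n))"
        using T_lt_1 by (intro mult_right_mono) auto
      finally have 2: "norm (T (U n - restrict_coords I (U n))) \<le> B" using B[OF n] by simp
      have "T w = (T (U n) - g) - T (U n - restrict_coords I (U n)) - (T (restrict_coords I (U N)) - g)"
        by (simp add: w_def diff)
      then show ?thesis
        using 1 2 norm_triangle_ineq4[of "T (U n) - g" "T (U n - restrict_coords I (U n))"]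
          norm_triangle_ineq4[of "(T (U n) - g) - T (U n - restrict_coords I (U n))" "T (restrict_coords I (U N)) - g"]
        by (simp add: K_def)
    qed
    then have "c * norm (T w) \<le> c * K" using c by (rule mult_left_mono)
    moreover have "U n = (U n - restrict_coords I (U n)) + w + restrict_coords I (U N)" by (simp add: w_def)
    then have "norm (U n) \<le> norm (U n - restrict_coords I (U n)) + norm w + norm (restrict_coords I (U N))"
      by (metis norm_triangle_le norm_triangle_ineq add_right_mono order_trans)
    ultimately show ?thesis using B[OF n] by linarith
  qed
  then show ?thesis by blast
qed

lemma U_converges_to_fixed_point:
  "\<exists>z. weakly_convergent_to U z \<and>
    (\<forall>i. coord z i = branch i (coord (grad_step z) i) \<and> (if i \<in> I then l \<le> \<bar>coord z i\<bar> else \<bar>coord z i\<bar> \<le> h l))"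
proof -
  obtain M where M: "\<And>n. norm (U (n + N)) \<le> M" using U_bounded by (meson le_add2)
  \<comment> \<open>Fixed points of the branch map, not of \<open>HH\<close>: strict bounds become
    weak in the limit, and at a value of modulus exactly \<open>l\<close> on \<open>I\<close> the
    map \<open>cut\<close> would jump down.\<close>
  define Z where "Z = {z. \<forall>i. coord z i = branch i (coord (grad_step z) i)}"
  have cluster: "z \<in> Z" if \<rho>: "strict_mono (\<rho> :: nat \<Rightarrow> nat)"
    and lim: "\<And>i. (\<lambda>n. coord (U (\<rho> n + N)) i) \<longlonglongrightarrow> coord z i" for \<rho> z
  proof -
    have "coord z i = branch i (coord (grad_step z) i)" for i
    proof -
      have "(\<lambda>n. norm (U (Suc (n + N)) - U (n + N))) \<longlonglongrightarrow> 0"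
        using LIMSEQ_ignore_initial_segment[OF steps_tendsto_0, of N] by simp
      from LIMSEQ_subseq_LIMSEQ[OF this \<rho>]
      have "(\<lambda>n. norm (U (Suc (\<rho> n + N)) - U (\<rho> n + N))) \<longlonglongrightarrow> 0" by (simp add: o_def)
      then have "(\<lambda>n. coord (U (Suc (\<rho> n + N))) i - coord (U (\<rho> n + N)) i) \<longlonglongrightarrow> 0"
        using abs_coord_le_norm[of "U (Suc (\<rho> n + N)) - U (\<rho> n + N)" i for n]
        by (elim Lim_null_comparison[rotated]) simp
      from tendsto_add[OF this lim[of i]]
      have 1: "(\<lambda>n. branch i (coord (grad_step (U (\<rho> n + N))) i)) \<longlonglongrightarrow> coord z i"
        by (simp add: coord_U_Suc)
      have "(\<lambda>n. coord (grad_step (U (\<rho> n + N))) i) \<longlonglongrightarrow> coord (grad_step z) i"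
        by (rule coord_grad_step_tendsto[OF M lim])
      then have "(\<lambda>n. branch i (coord (grad_step (U (\<rho> n + N))) i)) \<longlonglongrightarrow> branch i (coord (grad_step z) i)"
        unfolding branch_def by (cases "i \<in> I") (simp_all add: tendsto_h)
      with 1 show ?thesis by (rule LIMSEQ_unique)
    qed
    then show ?thesis by (simp add: Z_def)
  qed
  have fejer: "norm (U (Suc n + N) - z) \<le> norm (U (n + N) - z)" if "z \<in> Z" for z n
  proof -
    have "norm (U (Suc n + N) - z) \<le> norm (grad_step (U (n + N)) - grad_step z)"
    proof (rule norm_le_of_abs_coord_le)
      fix i
      have "coord z i = branch i (coord (grad_step z) i)" using that unfolding Z_def by blast
      then show "\<bar>coord (U (Suc n + N) - z) i\<bar> \<le> \<bar>coord (grad_step (U (n + N)) - grad_step z) i\<bar>"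
        using branch_lipschitz[of i "coord (grad_step (U (n + N))) i" "coord (grad_step z) i"]
          coord_U_Suc[of "n + N" i] by simp
    qed
    also have "\<dots> \<le> norm (U (n + N) - z)" by (rule norm_grad_step_diff_le)
    finally show ?thesis .
  qed
  obtain z where z: "z \<in> Z" and lim: "\<And>i. (\<lambda>n. coord (U (n + N)) i) \<longlonglongrightarrow> coord z i"
    by (rule fejer_imp_coordwise_convergent[of "\<lambda>n. U (n + N)" M Z]) (use M cluster fejer in auto)
  have "weakly_convergent_to (\<lambda>n. U (n + N)) z"
    by (rule weakly_convergent_to_coordI[OF M lim])
  then have "weakly_convergent_to U z"
    unfolding weakly_convergent_to_def by (auto intro: LIMSEQ_offset)
  moreover have "if i \<in> I then l \<le> \<bar>coord z i\<bar> else \<bar>coord z i\<bar> \<le> h l" for i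
  proof (cases "i \<in> I")
    case True
    have "l \<le> \<bar>coord z i\<bar>"
      by (rule LIMSEQ_le_const[OF tendsto_rabs[OF lim]])
        (use frozen[of "_ + N" i] True in \<open>auto intro: less_imp_le\<close>)
    with True show ?thesis by simp
  next
    case False
    have "\<bar>coord z i\<bar> \<le> h l"
      by (rule LIMSEQ_le_const2[OF tendsto_rabs[OF lim]]) (use frozen[of "_ + N" i] False in auto)
    with False show ?thesis by simp
  qed
  ultimately show ?thesis using z unfolding Z_def by blast
qed

end

text \<open>Eliminates \<open>I\<close>: where the branch is the identity, the fixed point equation
  says that the residual coordinate vanishes.\<close>

lemma (in thresholded_landweber_sequence) converges_to_fixed_point:
  "\<exists>z. weakly_convergent_to U z \<and>
    (\<forall>i. l \<le> \<bar>coord z i\<bar> \<and> coord (adjoint T (g - T z)) i = 0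
       \<or> \<bar>coord z i\<bar> \<le> h l \<and> coord z i = h (coord z i + coord (adjoint T (g - T z)) i))"
proof -
  obtain N I where "finite I"
    "\<And>n i. n \<ge> N \<Longrightarrow> if i \<in> I then l < \<bar>coord (U n) i\<bar> else \<bar>coord (U n) i\<bar> \<le> h l"
    using support_freezes by blast
  then interpret frozen_sequence p r l h T g u0 N I
    by unfold_locales
  obtain z where z: "weakly_convergent_to U z"
    "\<And>i. coord z i = branch i (coord (grad_step z) i)"
    "\<And>i. if i \<in> I then l \<le> \<bar>coord z i\<bar> else \<bar>coord z i\<bar> \<le> h l"
    using U_converges_to_fixed_point by blast
  have "l \<le> \<bar>coord z i\<bar> \<and> coord (adjoint T (g - T z)) i = 0
       \<or> \<bar>coord z i\<bar> \<le> h l \<and> coord z i = h (coord z i + coord (adjoint T (g - T z)) i)" for i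
    using z(2)[of i] z(3)[of i] by (cases "i \<in> I") (auto simp: branch_def grad_step_eq)
  with z(1) show ?thesis by blast
qed

theorem theorem4p5p7:
  fixes T :: "'i::countable ell2 \<Rightarrow> 'k::countable ell2"
    and g :: "'k ell2"
    and u0 :: "'i ell2"
    and p r :: real
  assumes p: "1 \<le> p \<and> p \<le> 2 \<or> finite (UNIV :: 'i set) \<and> 1 \<le> p"
    and r: "0 < r" "p = 1 \<Longrightarrow> 1/4 \<le> r"
    and T: "bounded_linear T" "onorm T < 1"
    and u0: "J T g p r u0 < \<infinity>"
  shows "\<exists>ubar :: 'i ell2.
    weakly_convergent_to (\<lambda>n. (HH T g p r ^^ n) u0) ubar
    \<and> (\<forall>i. r < \<bar>coord ubar i\<bar> \<longrightarrow> lam r p \<le> \<bar>coord ubar i\<bar>)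
    \<and> (1 < p \<longrightarrow> (\<forall>i. \<bar>coord ubar i\<bar> \<le> r \<longrightarrow> \<bar>coord ubar i\<bar> \<le> Fp_inv p (lam r p)))
    \<and> (1 < p \<longrightarrow>
        (\<forall>i. (lam r p \<le> \<bar>coord ubar i\<bar> \<longrightarrow> coord (adjoint T (g - T ubar)) i = 0)
           \<and> (\<bar>coord ubar i\<bar> \<le> lam r p - jump r p \<longrightarrow>
                coord (adjoint T (g - T ubar)) i = Fp p (coord ubar i) - coord ubar i)))
    \<and> (p = 1 \<longrightarrow>
        (\<forall>i. (\<bar>coord ubar i\<bar> \<le> 1/2 \<longrightarrow> coord (adjoint T (g - T ubar)) i \<in> {-1/2..1/2})
           \<and> (1/2 < \<bar>coord ubar i\<bar> \<and> \<bar>coord ubar i\<bar> \<le> r - 1/4 \<longrightarrow>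
                coord (adjoint T (g - T ubar)) i = 1/2 * sgn (coord ubar i))
           \<and> (r + 1/4 < \<bar>coord ubar i\<bar> \<longrightarrow> coord (adjoint T (g - T ubar)) i = 0)))"
proof -
  interpret bounded_linear T by (rule T(1))
  have p1: "1 \<le> p" and p2: "p \<le> 2 \<or> finite (UNIV :: 'i set)" using p by auto
  have summable: "(\<lambda>i. min (\<bar>coord u0 i\<bar> powr p) (r powr p)) summable_on UNIV"
    using u0 by (intro summable_on_of_ennreal_infsum_finite) (auto simp: J_def)
  show ?thesis
  proof (cases "p = 1")
    case True
    have r': "1/4 \<le> r" using r(2) True by simp
    interpret jump_threshold p r "lam r p" soft_threshold
      unfolding True by (rule jump_threshold_soft[OF r'])
    interpret thresholded_landweber_sequence p r "lam r p" soft_threshold T g u0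
      by unfold_locales (use T summable p2 H_eq_cut_soft[OF r'] True in auto)
    have lam: "lam r p = r + 1/4" and soft_lam: "soft_threshold (r + 1/4) = r - 1/4"
      using r' True by (auto simp: lam_def soft_threshold_def)
    obtain z where z: "weakly_convergent_to U z" and
      fp_all: "\<forall>i. lam r p \<le> \<bar>coord z i\<bar> \<and> coord (adjoint T (g - T z)) i = 0
         \<or> \<bar>coord z i\<bar> \<le> soft_threshold (lam r p) \<and> coord z i = soft_threshold (coord z i + coord (adjoint T (g - T z)) i)"
      using converges_to_fixed_point by (elim exE conjE) (rule that)
    have fp: "r + 1/4 \<le> \<bar>coord z i\<bar> \<and> coord (adjoint T (g - T z)) i = 0
         \<or> \<bar>coord z i\<bar> \<le> r - 1/4 \<and> coord z i = soft_threshold (coord z i + coord (adjoint T (g - T z)) i)" for i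
      by (rule spec[OF fp_all, unfolded lam soft_lam])
    \<comment> \<open>A fixed point of soft thresholding after adding \<open>c\<close> means that
      \<open>2 * c\<close> is a subgradient of the absolute value at \<open>x\<close>.\<close>
    have soft_fp: "c \<in> {-1/2..1/2} \<and> (x \<noteq> 0 \<longrightarrow> c = 1/2 * sgn x)" if "soft_threshold (x + c) = x" for x c :: real
    proof -
      consider "\<bar>x + c\<bar> \<le> 1/2" | "1/2 < x + c" | "x + c < -1/2" by linarith
      then show ?thesis
      proof cases
        case 1
        then have "x = 0" using that by (simp add: soft_threshold_def)
        then show ?thesis using 1 by auto
      next
        case 2
        then have "x = (x + c) - 1/2" using that by (auto simp: soft_threshold_def)
        then show ?thesis using 2 by auto
      next
        case 3
        then have "x = (x + c) + 1/2" using that by (auto simp: soft_threshold_def)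
        then show ?thesis using 3 by auto
      qed
    qed
    have fp': "coord (adjoint T (g - T z)) i \<in> {-1/2..1/2}
        \<and> (\<bar>coord z i\<bar> \<le> r - 1/4 \<and> coord z i \<noteq> 0
            \<longrightarrow> coord (adjoint T (g - T z)) i = 1/2 * sgn (coord z i))" for i
      using fp[of i]
    proof
      assume "r + 1/4 \<le> \<bar>coord z i\<bar> \<and> coord (adjoint T (g - T z)) i = 0"
      then show ?thesis by simp
    next
      assume "\<bar>coord z i\<bar> \<le> r - 1/4 \<and> coord z i = soft_threshold (coord z i + coord (adjoint T (g - T z)) i)"
      then show ?thesis by (metis soft_fp)
    qed
    show ?thesis
    proof (intro exI[of _ z] conjI allI impI)
      show "weakly_convergent_to (\<lambda>n. (HH T g p r ^^ n) u0) z"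
        using z by (simp only: U_def[abs_def])
    next
      fix i assume "r < \<bar>coord z i\<bar>"
      then show "lam r p \<le> \<bar>coord z i\<bar>" using fp[of i] unfolding lam by linarith
    next
      fix i
      show "coord (adjoint T (g - T z)) i \<in> {-1/2..1/2}" using fp' by blast
    next
      fix i assume "1/2 < \<bar>coord z i\<bar> \<and> \<bar>coord z i\<bar> \<le> r - 1/4"
      moreover from this have "coord z i \<noteq> 0" by auto
      ultimately show "coord (adjoint T (g - T z)) i = 1/2 * sgn (coord z i)" using fp' by blast
    next
      fix i assume "r + 1/4 < \<bar>coord z i\<bar>"
      then show "coord (adjoint T (g - T z)) i = 0" using fp[of i] by linarith
    qed (use True in auto)
  next
    case False
    then have p_gt1: "1 < p" using p1 by simp
    interpret jump_threshold p r "lam r p" "Fp_inv p"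
      by (rule jump_threshold_Fp_inv[OF p_gt1 r(1)])
    interpret thresholded_landweber_sequence p r "lam r p" "Fp_inv p" T g u0
      by unfold_locales (use T summable p2 H_eq_cut[OF p_gt1 r(1)] in auto)
    obtain z where z: "weakly_convergent_to U z" and
      fp_all: "\<forall>i. lam r p \<le> \<bar>coord z i\<bar> \<and> coord (adjoint T (g - T z)) i = 0
         \<or> \<bar>coord z i\<bar> \<le> Fp_inv p (lam r p)
           \<and> coord z i = Fp_inv p (coord z i + coord (adjoint T (g - T z)) i)"
      using converges_to_fixed_point by (elim exE conjE) (rule that)
    note fp = spec[OF fp_all]
    \<comment> \<open>Since \<open>r\<close> lies in the gap, comparing a coordinate with
      \<open>r\<close> decides which alternative of \<open>fp\<close> holds.\<close>
    have gap: "Fp_inv p (lam r p) \<le> r" "r < lam r p" by (rule h_l_le_r, rule r_less_l)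
    \<comment> \<open>At the threshold itself \<open>H\<close> still takes the \<open>Fp_inv\<close>
      branch.\<close>
    have jump: "lam r p - jump r p = Fp_inv p (lam r p)"
      using False l0 by (simp add: jump_def H_def)
    show ?thesis
    proof (intro exI[of _ z] conjI allI impI)
      show "weakly_convergent_to (\<lambda>n. (HH T g p r ^^ n) u0) z"
        using z by (simp only: U_def[abs_def])
    next
      fix i assume "r < \<bar>coord z i\<bar>"
      then show "lam r p \<le> \<bar>coord z i\<bar>" using fp[of i] gap by linarith
    next
      fix i assume "\<bar>coord z i\<bar> \<le> r"
      then show "\<bar>coord z i\<bar> \<le> Fp_inv p (lam r p)" using fp[of i] gap by linarith
    next
      fix i assume "lam r p \<le> \<bar>coord z i\<bar>"
      then show "coord (adjoint T (g - T z)) i = 0" using fp[of i] gap by linarith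
    next
      fix i assume "\<bar>coord z i\<bar> \<le> lam r p - jump r p"
      then have "coord z i = Fp_inv p (coord z i + coord (adjoint T (g - T z)) i)"
        using fp[of i] gap unfolding jump by linarith
      then have "Fp p (coord z i) = coord z i + coord (adjoint T (g - T z)) i"
        by (metis Fp_Fp_inv[OF p_gt1])
      then show "coord (adjoint T (g - T z)) i = Fp p (coord z i) - coord z i" by simp
    qed (use False in auto)
  qed
qed

end
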